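(* Let $K$ be a field (with the standing assumption on $\mathrm{char}(K)$ given in the context) and let $I\subset S=K[x_1,\dots,x_n]$ be a squarefree monomial ideal with an $(n-2)$-linear resolution. Then, for all $\ell=0,\dots,n-2$, the ideal $\partial^\ell(I)$ is vertex splittable, and so $$\mathrm{reg}\,\partial^\ell(I)=n-2-\ell.$$
   Context: $S=K[x_1,\dots,x_n]$ is the standard graded polynomial ring over the field $K$. For a homogeneous ideal $I\subset S$, the gradient ideal $\partial(I)$ is the ideal generated by all partial derivatives $\partial f/\partial x_i$ ($1\le i\le n$) of the elements $f$ of a minimal generating set of $I$; $\partial^0(I)=I$, $\partial^1(I)=\partial(I)$ and $\partial^\ell(I)=\partial(\partial^{\ell-1}(I))$ for $\ell>1$. For a monomial ideal $I$, $\mathcal{G}(I)$ denotes its minimal monomial generating set, and $\mathrm{supp}(u)=\{i: x_i \text{ divides } u\}$ for a monomial $u$. Standing assumption: $\mathrm{char}(K)=0$, or $\mathrm{char}(K)$ is large enough that for every monomial ideal $I$ under consideration $$\partial(I)=(u/x_i:\ u\in\mathcal{G}(I),\ i\in\mathrm{supp}(u)).$$ For a homogeneous ideal $I$, $\mathrm{reg}\,I=\max\{j-i:\ \dim_K\mathrm{Tor}^S_i(K,I)_j\neq 0\}$ is the Castelnuovo–Mumford regularity. A nonzero homogeneous ideal $I$ has a $d$-linear resolution if all its minimal homogeneous generators have degree $d$ and $\mathrm{reg}\,I=d$. A monomial ideal $I\subset S$ is vertex splittable if it can be obtained by the following recursive procedure: (i) if $u$ is a monomial and $I=(u)$, $I=(0)$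 or $I=S$, then $I$ is vertex splittable; (ii) if there exist a variable $x_i$ and vertex splittable ideals $I_1\subset S$ and $I_2\subset K[x_1,\dots,x_{i-1},x_{i+1},\dots,x_n]$ such that $I=x_iI_1+I_2$, $I_2\subseteq I_1$ and $\mathcal{G}(I)$ is the disjoint union of $\mathcal{G}(x_iI_1)$ and $\mathcal{G}(I_2)$, then $I$ is vertex splittable. (Ideals generated by monomials in a subset of the variables are identified with their extensions to $S$.) *)

theory Defs
  imports Complex_Main "HOL-Library.Poly_Mapping" "HOL-Library.Function_Algebras"
    "HOL-Library.Cardinality"
begin

section \<open>The polynomial ring and its ideals\<close>

text \<open>
  The type \<open>('n, 'k) mpoly\<close> with \<open>'n :: finite\<close> and \<open>'k :: field\<close> is the polynomial ring
  \<open>S = K[x\<^sub>i : i \<in> 'n]\<close> in \<open>n = CARD('n)\<close> variables. Exponent vectors have type \<open>'n \<Rightarrow>\<^sub>0 nat\<close>.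
\<close>

type_synonym ('n, 'k) mpoly = "('n \<Rightarrow>\<^sub>0 nat) \<Rightarrow>\<^sub>0 'k"

definition mon :: "('n \<Rightarrow>\<^sub>0 nat) \<Rightarrow> ('n, 'k::field) mpoly" where
  "mon m = Poly_Mapping.single m 1"

definition var :: "'n \<Rightarrow> ('n, 'k::field) mpoly" where
  "var i = mon (Poly_Mapping.single i 1)"

definition homogeneous :: "int \<Rightarrow> ('n::finite, 'k::field) mpoly \<Rightarrow> bool" where
  "homogeneous d f \<longleftrightarrow>
     (\<forall>m \<in> Poly_Mapping.keys f. int (\<Sum>i\<in>UNIV. Poly_Mapping.lookup m i) = d)"

definition partial_deriv :: "'n \<Rightarrow> ('n, 'k::field) mpoly \<Rightarrow> ('n, 'k) mpoly" where
  "partial_deriv i f =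
     (\<Sum>m \<in> Poly_Mapping.keys f.
        Poly_Mapping.single (m - Poly_Mapping.single i 1)
          (of_nat (Poly_Mapping.lookup m i) * Poly_Mapping.lookup f m))"

text \<open>Ideals of \<open>S\<close> are the submodules of \<open>S\<close> as a module over itself.\<close>

lemma module_times: "module ((*) :: 'a::comm_ring_1 \<Rightarrow> 'a \<Rightarrow> 'a)"
  by unfold_locales (simp_all add: algebra_simps)

definition ideal_gen :: "('n, 'k::field) mpoly set \<Rightarrow> ('n, 'k) mpoly set" where
  "ideal_gen G = module.span (*) G"

definition minimal_generating_set ::
    "('n, 'k::field) mpoly set \<Rightarrow> ('n, 'k) mpoly set \<Rightarrow> bool" where
  "minimal_generating_set G I \<longleftrightarrow> ideal_gen G = I \<and> (\<forall>H. H \<subset> G \<longrightarrow> ideal_gen H \<noteq> I)"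

definition minimal_homogeneous_generating_set ::
    "('n::finite, 'k::field) mpoly set \<Rightarrow> ('n, 'k) mpoly set \<Rightarrow> bool" where
  "minimal_homogeneous_generating_set G I \<longleftrightarrow>
     (\<forall>f \<in> G. \<exists>d. homogeneous d f) \<and> minimal_generating_set G I"

definition homogeneous_ideal :: "('n::finite, 'k::field) mpoly set \<Rightarrow> bool" where
  "homogeneous_ideal I \<longleftrightarrow> (\<exists>G. (\<forall>f \<in> G. \<exists>d. homogeneous d f) \<and> I = ideal_gen G)"


section \<open>Monomial ideals\<close>

text \<open>
  For a monomial ideal the minimal generating set consisting of monomials is unique, so that
  the definite description below denotes it.
\<close>

definition min_mon_gens :: "('n, 'k::field) mpoly set \<Rightarrow> ('n, 'k) mpoly set" where
  "min_mon_gens I = (THE G. G \<subseteq> range mon \<and> minimal_generating_set G I)"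

definition squarefree_monomial_ideal :: "('n, 'k::field) mpoly set \<Rightarrow> bool" where
  "squarefree_monomial_ideal I \<longleftrightarrow>
     (\<exists>G. G \<subseteq> mon ` {m. \<forall>i. Poly_Mapping.lookup m i \<le> 1} \<and> I = ideal_gen G)"

text \<open>
  In \<open>vertex_splittable_in V I\<close>, the set \<open>V\<close> records which variables are present: an ideal of
  \<open>K[x\<^sub>j : j \<in> V]\<close> is identified with its extension \<open>I\<close> to \<open>S\<close>. The second rule therefore
  requires \<open>I\<^sub>2\<close> to be vertex splittable in the ring without the variable \<open>x\<^sub>i\<close>.
\<close>

inductive vertex_splittable_in :: "'n set \<Rightarrow> ('n, 'k::field) mpoly set \<Rightarrow> bool" where
  principal: "Poly_Mapping.keys m \<subseteq> V \<Longrightarrow> vertex_splittable_in V (ideal_gen {mon m})"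
| zero: "vertex_splittable_in V {0}"
| whole: "vertex_splittable_in V UNIV"
| split: "\<lbrakk>i \<in> V; vertex_splittable_in V I\<^sub>1; vertex_splittable_in (V - {i}) I\<^sub>2;
    I = {var i * f + g | f g. f \<in> I\<^sub>1 \<and> g \<in> I\<^sub>2}; I\<^sub>2 \<subseteq> I\<^sub>1;
    min_mon_gens I = min_mon_gens ((*) (var i) ` I\<^sub>1) \<union> min_mon_gens I\<^sub>2;
    min_mon_gens ((*) (var i) ` I\<^sub>1) \<inter> min_mon_gens I\<^sub>2 = {}\<rbrakk>
    \<Longrightarrow> vertex_splittable_in V I"

definition vertex_splittable :: "('n, 'k::field) mpoly set \<Rightarrow> bool" where
  "vertex_splittable I \<longleftrightarrow> vertex_splittable_in UNIV I"


section \<open>Gradient ideals\<close>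

definition gradient_ideal :: "('n::finite, 'k::field) mpoly set \<Rightarrow> ('n, 'k) mpoly set" where
  "gradient_ideal I =
     ideal_gen {partial_deriv i f | i f. f \<in> (SOME G. minimal_homogeneous_generating_set G I)}"

text \<open>The quotients \<open>v = u / x\<^sub>i\<close> are described by \<open>u = x\<^sub>i v\<close>.\<close>

definition monomial_gradient :: "('n, 'k::field) mpoly set \<Rightarrow> ('n, 'k) mpoly set" where
  "monomial_gradient I = ideal_gen {v. \<exists>u \<in> min_mon_gens I. \<exists>i. u = var i * v}"


section \<open>Tor and regularity\<close>

text \<open>
  The data of a complex of finitely generated graded free \<open>S\<close>-modules
  \<open>\<dots> \<rightarrow> F\<^sub>2 \<rightarrow> F\<^sub>1 \<rightarrow> F\<^sub>0 \<rightarrow> K\<close>, where \<open>F\<^sub>p\<close> is the direct sum of the modules \<open>S(- shift p c)\<close>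
  for \<open>c < rk p\<close>. The map \<open>F\<^sub>p\<^sub>+\<^sub>1 \<rightarrow> F\<^sub>p\<close> is given by the matrix with entry
  \<open>mat p r c\<close> in row \<open>r\<close> and column \<open>c\<close>; the augmentation \<open>F\<^sub>0 \<rightarrow> K = S/(x\<^sub>i : i \<in> 'n)\<close>
  sends the basis vector with index \<open>c\<close> to \<open>aug c\<close>.
\<close>

record (overloaded) ('n, 'k) free_complex =
  rk :: "nat \<Rightarrow> nat"
  shift :: "nat \<Rightarrow> nat \<Rightarrow> int"
  mat :: "nat \<Rightarrow> nat \<Rightarrow> nat \<Rightarrow> ('n, 'k::zero) mpoly"
  aug :: "nat \<Rightarrow> 'k"

text \<open>
  The module \<open>F\<^sub>p \<otimes> I\<close> is the direct sum of \<open>rk p\<close> copies of \<open>I\<close>, with grading shifted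
  accordingly. The choice \<open>I = UNIV\<close> gives \<open>F\<^sub>p\<close> itself.
\<close>

definition chains :: "('n, 'k::field) free_complex \<Rightarrow> ('n, 'k) mpoly set \<Rightarrow> nat
    \<Rightarrow> (nat \<Rightarrow> ('n, 'k) mpoly) set" where
  "chains F I p = {v. (\<forall>c < rk F p. v c \<in> I) \<and> (\<forall>c \<ge> rk F p. v c = 0)}"

definition chains_deg :: "('n::finite, 'k::field) free_complex \<Rightarrow> nat \<Rightarrow> int
    \<Rightarrow> (nat \<Rightarrow> ('n, 'k) mpoly) set" where
  "chains_deg F p j = {v. \<forall>c < rk F p. homogeneous (j - shift F p c) (v c)}"

definition boundary_map :: "('n, 'k::field) free_complex \<Rightarrow> nat
    \<Rightarrow> (nat \<Rightarrow> ('n, 'k) mpoly) \<Rightarrow> nat \<Rightarrow> ('n, 'k) mpoly" where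
  "boundary_map F p v = (\<lambda>r. if r < rk F p then \<Sum>c < rk F (Suc p). mat F p r c * v c else 0)"

definition cycles :: "('n, 'k::field) free_complex \<Rightarrow> ('n, 'k) mpoly set \<Rightarrow> nat
    \<Rightarrow> (nat \<Rightarrow> ('n, 'k) mpoly) set" where
  "cycles F I p =
     {v \<in> chains F I p. case p of 0 \<Rightarrow> True | Suc q \<Rightarrow> boundary_map F q v = 0}"

definition boundaries :: "('n, 'k::field) free_complex \<Rightarrow> ('n, 'k) mpoly set \<Rightarrow> nat
    \<Rightarrow> (nat \<Rightarrow> ('n, 'k) mpoly) set" where
  "boundaries F I p = boundary_map F p ` chains F I (Suc p)"

definition augmentation :: "('n, 'k::field) free_complex \<Rightarrow> (nat \<Rightarrow> ('n, 'k) mpoly) \<Rightarrow> 'k" where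
  "augmentation F v = (\<Sum>c < rk F 0. aug F c * Poly_Mapping.lookup (v c) 0)"

definition graded_free_resolution_of_field :: "('n::finite, 'k::field) free_complex \<Rightarrow> bool" where
  "graded_free_resolution_of_field F \<longleftrightarrow>
     (\<forall>p. \<forall>r < rk F p. \<forall>c < rk F (Suc p).
        homogeneous (shift F (Suc p) c - shift F p r) (mat F p r c)) \<and>
     (\<forall>c < rk F 0. aug F c \<noteq> 0 \<longrightarrow> shift F 0 c = 0) \<and>
     augmentation F ` chains F UNIV 0 = UNIV \<and>
     {v \<in> chains F UNIV 0. augmentation F v = 0} = boundaries F UNIV 0 \<and>
     (\<forall>p. cycles F UNIV (Suc p) = boundaries F UNIV (Suc p))"

text \<open>
  \<open>tor_dim I i j\<close> is the dimension over \<open>K\<close> of the degree \<open>j\<close> component of \<open>Tor\<^sub>i(K, I)\<close>,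
  which is the homology in position \<open>i\<close> of \<open>F \<otimes> I\<close> for a graded free resolution \<open>F\<close> of \<open>K\<close>;
  up to isomorphism it does not depend on the choice of \<open>F\<close>. The subtraction is never truncated
  because boundaries are cycles.
\<close>

definition kscale :: "'k::field \<Rightarrow> (nat \<Rightarrow> ('n, 'k) mpoly) \<Rightarrow> nat \<Rightarrow> ('n, 'k) mpoly" where
  "kscale a v = (\<lambda>c. Poly_Mapping.single 0 a * v c)"

lemma vector_space_kscale: "vector_space kscale"
  by unfold_locales
    (auto simp: kscale_def fun_eq_iff algebra_simps single_add mult_single
      simp flip: mult.assoc)

definition tor_dim :: "('n::finite, 'k::field) mpoly set \<Rightarrow> nat \<Rightarrow> int \<Rightarrow> nat" where
  "tor_dim I i j =
     (let F = (SOME F. graded_free_resolution_of_field F) in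
        vector_space.dim kscale (cycles F I i \<inter> chains_deg F i j)
      - vector_space.dim kscale (boundaries F I i \<inter> chains_deg F i j))"

definition regularity :: "('n::finite, 'k::field) mpoly set \<Rightarrow> int" where
  "regularity I = Max {j - int i | i j. tor_dim I i j \<noteq> 0}"

definition has_linear_resolution :: "int \<Rightarrow> ('n::finite, 'k::field) mpoly set \<Rightarrow> bool" where
  "has_linear_resolution d I \<longleftrightarrow>
     homogeneous_ideal I \<and> I \<noteq> {0} \<and>
     (\<forall>G. minimal_homogeneous_generating_set G I \<longrightarrow> (\<forall>f \<in> G. homogeneous d f)) \<and>
     regularity I = d"

end

theory Submission
  imports Defs
begin

text \<open>
  A squarefree monomial of degree \<open>n - 2\<close> misses exactly two variables, so the ideal \<open>I\<close> is given by
  a graph: \<open>I\<close> is generated by the monomials \<open>x\<^bsub>[n] - e\<^esub>\<close> for the edges \<open>e\<close> of a graph on the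
  variables. Removing one more variable from a generator enlarges the set that is left out, hence
  \<open>\<partial>\<^sup>\<ell>(I)\<close> is generated by the monomials \<open>x\<^bsub>[n] - T\<^esub>\<close> for the sets \<open>T\<close> with \<open>\<ell> + 2\<close> elements that
  contain an edge (\<open>quotient_exponents_complement_gens\<close>). In characteristic zero the gradient ideal
  may be computed from the monomial generators, because by the formula of Euler and the product rule
  it is the same for all homogeneous generating sets (\<open>gradient_independent\<close>).

  The resolution of \<open>I\<close> is linear only if all edges of the graph lie in one connected component
  (\<open>linear_imp_grown\<close>). Otherwise \<open>I = I\<^sub>1 + I\<^sub>2\<close>, where the edges that belong to \<open>I\<^sub>1\<close> are disjoint
  from those that belong to \<open>I\<^sub>2\<close>. Then \<open>I\<^sub>1 \<inter> I\<^sub>2\<close> is generated by the product of all variables,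
  and the Mayer-Vietoris sequence gives a class in \<open>Tor\<^sub>1(K, I)\<close> of degree \<open>n\<close>, which is one more
  than linearity permits (\<open>not_tor_vanishes_union\<close>).

  Conversely, a graph of this kind is built from one edge by adding vertices one at a time, each
  either isolated or adjacent to an older vertex. In the opposite order these vertices split the
  ideals \<open>\<partial>\<^sup>\<ell>(I)\<close> (\<open>vertex_splitting_grown\<close>). The generators that contain \<open>x\<^sub>v\<close> belong to the
  smaller graph. Those without \<open>x\<^sub>v\<close> come from sets \<open>T\<close> that contain \<open>v\<close>; removing \<open>v\<close> from \<open>T\<close>
  leaves a set that contains an old edge or meets the neighbourhood of \<open>v\<close>. If \<open>v\<close> has a neighbour
  \<open>u\<close>, then an ideal of the latter kind can be split at every vertex other than \<open>u\<close>
  (\<open>vertex_splitting_complement_gens_point\<close>).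

  Along a vertex splitting \<open>I = x\<^sub>vI\<^sub>1 + I\<^sub>2\<close> one has \<open>x\<^sub>vI\<^sub>1 \<inter> I\<^sub>2 = x\<^sub>vI\<^sub>2\<close>, so the Mayer-Vietoris
  sequence shows by induction that a vertex splittable ideal generated in one degree has a linear
  resolution (\<open>vertex_splitting_linear\<close>), which determines its regularity.

  The statements on \<open>Tor\<close> that are needed only say in which degrees it vanishes. They are proved for
  an arbitrary free resolution of \<open>K\<close>, without comparing resolutions; the existence of one is shown
  by an explicit construction (\<open>word_complex_resolution\<close>).
\<close>

section \<open>Polynomials and monomial ideals\<close>

abbreviation "lookup \<equiv> Poly_Mapping.lookup"
abbreviation "keys \<equiv> Poly_Mapping.keys"
abbreviation "single \<equiv> Poly_Mapping.single"

definition divides :: "('n \<Rightarrow>\<^sub>0 nat) \<Rightarrow> ('n \<Rightarrow>\<^sub>0 nat) \<Rightarrow> bool" (infix "\<preceq>" 50) where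
  "a \<preceq> m \<longleftrightarrow> (\<forall>i. lookup a i \<le> lookup m i)"

definition total_degree :: "('n::finite \<Rightarrow>\<^sub>0 nat) \<Rightarrow> nat" where
  "total_degree m = (\<Sum>i\<in>UNIV. lookup m i)"

lemma homogeneous_iff: "homogeneous d f \<longleftrightarrow> (\<forall>m\<in>keys f. int (total_degree m) = d)"
  by (simp add: homogeneous_def total_degree_def)

lemma divides_refl [simp, intro]: "a \<preceq> a" and divides_zero [simp]: "0 \<preceq> a"
  and divides_add [simp]: "a \<preceq> a + b" "b \<preceq> a + b"
  by (simp_all add: divides_def lookup_add)

lemma divides_trans: "a \<preceq> b \<Longrightarrow> b \<preceq> c \<Longrightarrow> a \<preceq> c"
  unfolding divides_def using le_trans by blast

lemma divides_antisym: "a \<preceq> b \<Longrightarrow> b \<preceq> a \<Longrightarrow> a = b"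
  by (rule poly_mapping_eqI) (simp add: divides_def le_antisym)

lemma divides_add_minus: "a \<preceq> m \<Longrightarrow> a + (m - a) = m"
  by (rule poly_mapping_eqI) (simp add: divides_def lookup_add lookup_minus)

lemma divides_iff_add: "a \<preceq> m \<longleftrightarrow> (\<exists>b. m = a + b)"
  using divides_add_minus divides_add by metis

lemma divides_add_cancel [simp]: "u + a \<preceq> u + b \<longleftrightarrow> a \<preceq> b"
  by (simp add: divides_def lookup_add)

lemma total_degree_add: "total_degree (a + b) = total_degree a + total_degree b"
  by (simp add: total_degree_def lookup_add sum.distrib)

lemma total_degree_zero [simp]: "total_degree 0 = 0"
  by (simp add: total_degree_def)

lemma total_degree_eq_0_iff: "total_degree a = 0 \<longleftrightarrow> a = 0"
  by (auto simp: total_degree_def intro: poly_mapping_eqI)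

lemma total_degree_mono: "a \<preceq> b \<Longrightarrow> total_degree a \<le> total_degree b"
  by (auto simp: divides_iff_add total_degree_add)

lemma divides_total_degree_eq: "a \<preceq> b \<Longrightarrow> total_degree a = total_degree b \<Longrightarrow> a = b"
  by (auto simp: divides_iff_add total_degree_add total_degree_eq_0_iff)

lemma finite_total_degree: "finite {m :: 'n::finite \<Rightarrow>\<^sub>0 nat. total_degree m = d}"
proof -
  let ?B = "{f :: 'n \<Rightarrow> nat. \<forall>i. (i \<in> UNIV \<longrightarrow> f i \<in> {..d}) \<and> (i \<notin> UNIV \<longrightarrow> f i = 0)}"
  have "finite ?B"
    by (rule finite_set_of_finite_funs) auto
  moreover have "lookup ` {m :: 'n \<Rightarrow>\<^sub>0 nat. total_degree m = d} \<subseteq> ?B"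
    by (auto simp: total_degree_def intro: member_le_sum)
  ultimately have "finite (lookup ` {m :: 'n \<Rightarrow>\<^sub>0 nat. total_degree m = d})"
    using finite_subset by blast
  then show ?thesis
    by (rule finite_imageD) (simp add: inj_on_def)
qed

text \<open>The exponent vector of the product of the variables in \<open>T\<close>.\<close>

definition chi :: "'n::finite set \<Rightarrow> 'n \<Rightarrow>\<^sub>0 nat" where
  "chi T = Abs_poly_mapping (\<lambda>i. if i \<in> T then 1 else 0)"

lemma lookup_chi: "lookup (chi T) i = (if i \<in> T then 1 else 0)"
  by (simp add: chi_def)

lemma chi_empty [simp]: "chi {} = 0"
  by (rule poly_mapping_eqI) (simp add: lookup_chi)

lemma total_degree_chi: "total_degree (chi T) = card T"
  by (simp add: total_degree_def lookup_chi sum.If_cases)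

lemma chi_divides_iff: "chi S \<preceq> m \<longleftrightarrow> (\<forall>i\<in>S. lookup m i \<noteq> 0)"
  by (auto simp: divides_def lookup_chi Suc_le_eq)

lemma lookup_single_times:
  fixes f :: "('n, 'k::field) mpoly"
  shows "lookup (single a c * f) m = (if a \<preceq> m then c * lookup f (m - a) else 0)"
proof -
  have "lookup (single a c * f) m =
      (\<Sum>l. (c * (\<Sum>q. lookup f q when m = l + q)) when l = a)"
    by (simp add: lookup_mult lookup_single when_mult eq_commute[of a])
  also have "\<dots> = c * (\<Sum>q. lookup f q when m = a + q)"
    by simp
  finally have *: "lookup (single a c * f) m = c * (\<Sum>q. lookup f q when m = a + q)" .
  show ?thesis
  proof (cases "a \<preceq> m")
    case True
    then have "m = a + q \<longleftrightarrow> q = m - a" for q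
      using divides_add_minus[OF True] by auto
    then show ?thesis using True * by simp
  next
    case False
    then have "m \<noteq> a + q" for q by auto
    then show ?thesis using False * by simp
  qed
qed

lemma lookup_mon_times:
  "lookup (mon a * f) m = (if a \<preceq> m then lookup f (m - a) else 0)"
  by (simp add: mon_def lookup_single_times)

lemma mon_times_cancel: "mon u * f = mon u * g \<longleftrightarrow> f = g"
proof
  assume *: "mon u * f = mon u * g"
  show "f = g"
  proof (rule poly_mapping_eqI)
    fix m
    show "lookup f m = lookup g m"
      using arg_cong[OF *, of "\<lambda>h. lookup h (u + m)"] by (simp add: lookup_mon_times)
  qed
qed simp

lemma mon_add: "mon (a + b) = mon a * mon b"
  by (simp add: mon_def mult_single)

lemma mon_zero [simp]: "mon 0 = 1"
  by (simp add: mon_def)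

lemma mon_eq_iff [simp]: "mon a = (mon b :: ('n, 'k::field) mpoly) \<longleftrightarrow> a = b"
proof
  assume "mon a = (mon b :: ('n, 'k) mpoly)"
  from arg_cong[OF this, of keys] show "a = b" by (simp add: mon_def)
qed simp

lemma inj_mon: "inj (mon :: _ \<Rightarrow> ('n, 'k::field) mpoly)"
  by (simp add: inj_on_def)

lemma keys_mon [simp]: "keys (mon m :: ('n, 'k::field) mpoly) = {m}"
  by (simp add: mon_def)

lemma lookup_mon: "lookup (mon m) k = (if m = k then 1 else 0)"
  by (simp add: mon_def lookup_single when_def)

lemma keys_mon_times:
  "keys (mon u * f :: ('n, 'k::field) mpoly) = (+) u ` keys f"
proof -
  have "m \<in> keys (mon u * f) \<longleftrightarrow> m \<in> (+) u ` keys f" for m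
  proof
    assume m: "m \<in> keys (mon u * f)"
    then have "u \<preceq> m" and "m - u \<in> keys f"
      by (auto simp: in_keys_iff lookup_mon_times split: if_splits)
    then show "m \<in> (+) u ` keys f"
      by (auto intro!: image_eqI[of _ _ "m - u"] simp: divides_add_minus)
  next
    assume "m \<in> (+) u ` keys f"
    then show "m \<in> keys (mon u * f)"
      by (auto simp: in_keys_iff lookup_mon_times)
  qed
  then show ?thesis by blast
qed

lemma mpoly_sum_single:
  fixes f :: "('n, 'k::field) mpoly"
  assumes "finite S" "keys f \<subseteq> S"
  shows "f = (\<Sum>m\<in>S. single m (lookup f m))"
proof (rule poly_mapping_eqI)
  fix k
  show "lookup f k = lookup (\<Sum>m\<in>S. single m (lookup f m)) k"
  proof (cases "k \<in> S")
    case True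
    then show ?thesis using assms
      by (simp add: lookup_sum lookup_single when_def sum.delta)
  next
    case False
    then have "lookup f k = 0" using assms by (auto simp: in_keys_iff)
    with False assms show ?thesis by (simp add: lookup_sum lookup_single when_def sum.delta)
  qed
qed

lemma lookup_zero_times:
  fixes f g :: "('n, 'k::field) mpoly"
  shows "lookup (g * f) 0 = lookup g 0 * lookup f 0"
proof -
  have "lookup (g * f) 0 = (\<Sum>m\<in>keys g. lookup (single m (lookup g m) * f) 0)"
    by (subst mpoly_sum_single[OF finite_keys subset_refl, of g])
      (simp add: sum_distrib_right lookup_sum)
  also have "\<dots> = (\<Sum>m\<in>keys g. if m = 0 then lookup g 0 * lookup f 0 else 0)"
    by (rule sum.cong)
      (auto simp: lookup_single_times divides_def intro!: poly_mapping_eqI)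
  also have "\<dots> = lookup g 0 * lookup f 0"
    by (simp add: sum.delta' in_keys_iff)
  finally show ?thesis .
qed

text \<open>
  Splitting a polynomial according to a property of its exponents is what makes sums of
  monomial ideals and homogeneous components easy to handle.
\<close>

definition restrict_keys :: "(('n \<Rightarrow>\<^sub>0 nat) \<Rightarrow> bool) \<Rightarrow> ('n, 'k::field) mpoly \<Rightarrow> ('n, 'k) mpoly" where
  "restrict_keys P f = Abs_poly_mapping (\<lambda>m. if P m then lookup f m else 0)"

lemma lookup_restrict_keys: "lookup (restrict_keys P f) m = (if P m then lookup f m else 0)"
  unfolding restrict_keys_def
  by (subst lookup_Abs_poly_mapping) (auto intro: finite_subset[OF _ finite_lookup[of f]])

lemma keys_restrict_keys: "keys (restrict_keys P f) = {m \<in> keys f. P m}"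
  by (auto simp: in_keys_iff lookup_restrict_keys split: if_splits)

lemma restrict_keys_split: "restrict_keys P f + restrict_keys (\<lambda>m. \<not> P m) f = f"
  by (rule poly_mapping_eqI) (simp add: lookup_add lookup_restrict_keys)

lemma restrict_keys_sum: "restrict_keys P (sum f S) = (\<Sum>x\<in>S. restrict_keys P (f x))"
  by (rule poly_mapping_eqI) (simp add: lookup_sum lookup_restrict_keys)

lemma restrict_keys_add: "restrict_keys P (f + g) = restrict_keys P f + restrict_keys P g"
  by (rule poly_mapping_eqI) (simp add: lookup_add lookup_restrict_keys)

lemma restrict_keys_zero [simp]: "restrict_keys P 0 = 0"
  by (rule poly_mapping_eqI) (simp add: lookup_restrict_keys)

lemma restrict_keys_id: "(\<And>m. m \<in> keys f \<Longrightarrow> P m) \<Longrightarrow> restrict_keys P f = f"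
  by (rule poly_mapping_eqI) (auto simp: lookup_restrict_keys in_keys_iff)

lemma restrict_keys_none: "(\<And>m. m \<in> keys f \<Longrightarrow> \<not> P m) \<Longrightarrow> restrict_keys P f = 0"
  by (rule poly_mapping_eqI) (auto simp: lookup_restrict_keys in_keys_iff)

definition hom_comp :: "int \<Rightarrow> ('n::finite, 'k::field) mpoly \<Rightarrow> ('n, 'k) mpoly" where
  "hom_comp d = restrict_keys (\<lambda>m. int (total_degree m) = d)"

lemma homogeneous_hom_comp: "homogeneous d (hom_comp d f)"
  by (auto simp: homogeneous_iff hom_comp_def keys_restrict_keys)

lemma hom_comp_homogeneous: "homogeneous d f \<Longrightarrow> hom_comp d f = f"
  unfolding hom_comp_def homogeneous_iff by (rule restrict_keys_id) auto

lemma hom_comp_times: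
  fixes f g :: "('n::finite, 'k::field) mpoly"
  assumes g: "homogeneous d g"
  shows "hom_comp (d + e) (g * f) = g * hom_comp e f"
proof -
  let ?h = "restrict_keys (\<lambda>m. int (total_degree m) \<noteq> e) f"
  have "g * f = g * hom_comp e f + g * ?h"
    unfolding hom_comp_def by (metis distrib_left restrict_keys_split)
  moreover have "hom_comp (d + e) (g * hom_comp e f) = g * hom_comp e f"
    using g keys_mult[of g "hom_comp e f"] homogeneous_hom_comp[of e f]
    by (intro hom_comp_homogeneous) (fastforce simp: homogeneous_iff total_degree_add)
  moreover have "hom_comp (d + e) (g * ?h) = 0"
    unfolding hom_comp_def
    using g keys_mult[of g ?h]
    by (intro restrict_keys_none)
       (fastforce simp: homogeneous_iff total_degree_add keys_restrict_keys)
  ultimately show ?thesis by (simp add: hom_comp_def restrict_keys_add)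
qed

lemma homogeneous_zero [simp]: "homogeneous d 0"
  by (simp add: homogeneous_iff)

lemma homogeneous_add: "homogeneous d f \<Longrightarrow> homogeneous d g \<Longrightarrow> homogeneous d (f + g)"
  using keys_add[of f g] by (auto simp: homogeneous_iff)

lemma keys_uminus [simp]: "keys (- f :: ('n, 'k::field) mpoly) = keys f"
  by (auto simp: in_keys_iff)

lemma homogeneous_uminus: "homogeneous d (- f) \<longleftrightarrow> homogeneous d f"
  by (simp add: homogeneous_iff)

lemma homogeneous_diff: "homogeneous d f \<Longrightarrow> homogeneous d g \<Longrightarrow> homogeneous d (f - g)"
  using homogeneous_add[of d f "- g"] by (simp add: homogeneous_uminus)

lemma homogeneous_sum: "(\<And>x. x \<in> S \<Longrightarrow> homogeneous d (f x)) \<Longrightarrow> homogeneous d (sum f S)"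
  by (induction S rule: infinite_finite_induct) (auto intro: homogeneous_add)

lemma homogeneous_mult: "homogeneous d f \<Longrightarrow> homogeneous e g \<Longrightarrow> homogeneous (d + e) (f * g)"
  using keys_mult[of f g] by (fastforce simp: homogeneous_iff total_degree_add)

lemma homogeneous_mon: "homogeneous d (mon m) \<longleftrightarrow> d = int (total_degree m)"
  by (auto simp: homogeneous_iff)

lemma homogeneous_mon_times:
  "homogeneous d (mon u * f) \<longleftrightarrow> homogeneous (d - int (total_degree u)) f"
  by (auto simp: homogeneous_iff keys_mon_times total_degree_add)

lemma homogeneous_restrict_keys: "homogeneous d f \<Longrightarrow> homogeneous d (restrict_keys P f)"
  by (auto simp: homogeneous_iff keys_restrict_keys)

subsection \<open>Monomial ideals\<close>

text \<open>A polynomial lies in the ideal generated by monomials iff each of its terms is divisible by one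
  of them. Taking this as the definition turns questions on ideals into questions on exponents.\<close>

definition monomial_ideal :: "('n \<Rightarrow>\<^sub>0 nat) set \<Rightarrow> ('n, 'k::field) mpoly set" where
  "monomial_ideal A = {f. \<forall>m\<in>keys f. \<exists>a\<in>A. a \<preceq> m}"

lemma monomial_ideal_zero [simp]: "0 \<in> monomial_ideal A"
  by (simp add: monomial_ideal_def)

lemma monomial_ideal_add: "f \<in> monomial_ideal A \<Longrightarrow> g \<in> monomial_ideal A \<Longrightarrow> f + g \<in> monomial_ideal A"
  using keys_add[of f g] by (auto simp: monomial_ideal_def)

lemma monomial_ideal_times: "f \<in> monomial_ideal A \<Longrightarrow> g * f \<in> monomial_ideal A"
  unfolding monomial_ideal_def using keys_mult[of g f] by (fastforce intro: divides_trans)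

lemma monomial_ideal_uminus: "- f \<in> monomial_ideal A \<longleftrightarrow> f \<in> monomial_ideal A"
  by (simp add: monomial_ideal_def)

lemma monomial_ideal_diff: "f \<in> monomial_ideal A \<Longrightarrow> g \<in> monomial_ideal A \<Longrightarrow> f - g \<in> monomial_ideal A"
  using monomial_ideal_add[of f A "- g"] by (simp add: monomial_ideal_uminus)

lemma monomial_ideal_sum: "(\<And>x. x \<in> S \<Longrightarrow> f x \<in> monomial_ideal A) \<Longrightarrow> sum f S \<in> monomial_ideal A"
  by (induction S rule: infinite_finite_induct) (auto intro: monomial_ideal_add)

lemma monomial_ideal_empty: "monomial_ideal {} = {0}"
  by (auto simp: monomial_ideal_def in_keys_iff intro!: poly_mapping_eqI)

lemma monomial_ideal_zero_exponent: "monomial_ideal {0} = UNIV"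
  by (auto simp: monomial_ideal_def)

lemma mon_in_monomial_ideal_iff: "mon m \<in> (monomial_ideal A :: ('n, 'k::field) mpoly set) \<longleftrightarrow>
    (\<exists>a\<in>A. a \<preceq> m)"
  by (simp add: monomial_ideal_def)

lemma mon_in_monomial_ideal: "a \<in> A \<Longrightarrow> mon a \<in> (monomial_ideal A :: ('n, 'k::field) mpoly set)"
  by (auto simp: mon_in_monomial_ideal_iff)

lemma restrict_keys_monomial_ideal: "f \<in> monomial_ideal A \<Longrightarrow> restrict_keys P f \<in> monomial_ideal A"
  by (auto simp: monomial_ideal_def keys_restrict_keys)

lemma monomial_ideal_subset_iff:
  "monomial_ideal A \<subseteq> (monomial_ideal B :: ('n, 'k::field) mpoly set) \<longleftrightarrow> (\<forall>a\<in>A. \<exists>b\<in>B. b \<preceq> a)"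
proof
  assume "monomial_ideal A \<subseteq> (monomial_ideal B :: ('n, 'k) mpoly set)"
  then show "\<forall>a\<in>A. \<exists>b\<in>B. b \<preceq> a"
    using mon_in_monomial_ideal mon_in_monomial_ideal_iff by blast
next
  assume "\<forall>a\<in>A. \<exists>b\<in>B. b \<preceq> a"
  then show "monomial_ideal A \<subseteq> (monomial_ideal B :: ('n, 'k) mpoly set)"
    unfolding monomial_ideal_def using divides_trans by blast
qed

lemma monomial_ideal_mono: "A \<subseteq> B \<Longrightarrow> monomial_ideal A \<subseteq> monomial_ideal B"
  unfolding monomial_ideal_def by blast

lemma monomial_ideal_translate:
  "monomial_ideal ((+) u ` A) = (*) (mon u) ` (monomial_ideal A :: ('n, 'k::field) mpoly set)"
proof (intro equalityI subsetI)
  fix f :: "('n, 'k) mpoly"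
  assume f: "f \<in> monomial_ideal ((+) u ` A)"
  define g :: "('n, 'k) mpoly" where "g = Abs_poly_mapping (\<lambda>m. lookup f (u + m))"
  have "finite {m. lookup f (u + m) \<noteq> 0}"
    using finite_vimageI[OF finite_keys[of f], of "(+) u"]
    by (simp add: vimage_def in_keys_iff)
  then have g: "lookup g m = lookup f (u + m)" for m
    by (simp add: g_def)
  have "f = mon u * g"
  proof (rule poly_mapping_eqI)
    fix m
    show "lookup f m = lookup (mon u * g) m"
    proof (cases "u \<preceq> m")
      case True
      then show ?thesis by (simp add: lookup_mon_times g divides_add_minus)
    next
      case False
      have "m \<notin> keys f"
        using f False by (force simp: monomial_ideal_def dest: divides_trans[OF divides_add(1)])
      then show ?thesis using False by (simp add: lookup_mon_times in_keys_iff)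
    qed
  qed
  moreover have "g \<in> monomial_ideal A"
    unfolding monomial_ideal_def
  proof (intro CollectI ballI)
    fix m assume "m \<in> keys g"
    then have "u + m \<in> keys f" by (simp add: g in_keys_iff)
    then obtain a where "a \<in> A" "u + a \<preceq> u + m" using f unfolding monomial_ideal_def by blast
    then show "\<exists>a\<in>A. a \<preceq> m" by auto
  qed
  ultimately show "f \<in> (*) (mon u) ` monomial_ideal A" by blast
next
  fix f :: "('n, 'k) mpoly"
  assume "f \<in> (*) (mon u) ` monomial_ideal A"
  then show "f \<in> monomial_ideal ((+) u ` A)"
    by (force simp: monomial_ideal_def keys_mon_times)
qed

lemma monomial_ideal_union_split:
  assumes "f \<in> monomial_ideal (A \<union> B)"
  shows "restrict_keys (\<lambda>m. \<exists>a\<in>A. a \<preceq> m) f \<in> monomial_ideal A"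
    and "restrict_keys (\<lambda>m. \<not> (\<exists>a\<in>A. a \<preceq> m)) f \<in> monomial_ideal B"
  using assms by (auto simp: monomial_ideal_def keys_restrict_keys)

lemma ideal_gen_subset:
  fixes G :: "('n, 'k::field) mpoly set"
  assumes "G \<subseteq> I" "0 \<in> I" "\<And>f g. f \<in> I \<Longrightarrow> g \<in> I \<Longrightarrow> f + g \<in> I" "\<And>f g. f \<in> I \<Longrightarrow> g * f \<in> I"
  shows "ideal_gen G \<subseteq> I"
proof -
  interpret R: module "(*) :: ('n, 'k) mpoly \<Rightarrow> _" by (rule module_times)
  show ?thesis unfolding ideal_gen_def
    by (rule R.span_minimal) (use assms in \<open>auto simp: R.subspace_def\<close>)
qed

lemma
  fixes G :: "('n, 'k::field) mpoly set"
  shows ideal_gen_base: "f \<in> G \<Longrightarrow> f \<in> ideal_gen G"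
    and ideal_gen_zero: "0 \<in> ideal_gen G"
    and ideal_gen_add: "f \<in> ideal_gen G \<Longrightarrow> g \<in> ideal_gen G \<Longrightarrow> f + g \<in> ideal_gen G"
    and ideal_gen_times: "f \<in> ideal_gen G \<Longrightarrow> g * f \<in> ideal_gen G"
    and ideal_gen_sum: "(\<And>x. x \<in> S \<Longrightarrow> h x \<in> ideal_gen G) \<Longrightarrow> sum h S \<in> ideal_gen G"
proof -
  interpret R: module "(*) :: ('n, 'k) mpoly \<Rightarrow> _" by (rule module_times)
  show "f \<in> G \<Longrightarrow> f \<in> ideal_gen G" "0 \<in> ideal_gen G"
    "f \<in> ideal_gen G \<Longrightarrow> g \<in> ideal_gen G \<Longrightarrow> f + g \<in> ideal_gen G"
    "f \<in> ideal_gen G \<Longrightarrow> g * f \<in> ideal_gen G"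
    "(\<And>x. x \<in> S \<Longrightarrow> h x \<in> ideal_gen G) \<Longrightarrow> sum h S \<in> ideal_gen G"
    unfolding ideal_gen_def
    by (auto intro: R.span_base R.span_zero R.span_add R.span_scale R.span_sum)
qed

lemma ideal_gen_mon: "ideal_gen (mon ` A) = (monomial_ideal A :: ('n, 'k::field) mpoly set)"
proof
  show "ideal_gen (mon ` A) \<subseteq> (monomial_ideal A :: ('n, 'k) mpoly set)"
    by (rule ideal_gen_subset) (auto
        intro: mon_in_monomial_ideal monomial_ideal_add monomial_ideal_times)
next
  show "(monomial_ideal A :: ('n, 'k) mpoly set) \<subseteq> ideal_gen (mon ` A)"
  proof
    fix f :: "('n, 'k) mpoly"
    assume f: "f \<in> monomial_ideal A"
    have "single m (lookup f m) \<in> ideal_gen (mon ` A)" if m: "m \<in> keys f" for m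
    proof -
      obtain a where a: "a \<in> A" "a \<preceq> m" using f m by (auto simp: monomial_ideal_def)
      then have "single m (lookup f m) = single (m - a) (lookup f m) * mon a"
        using divides_add_minus[of a m] by (simp add: mon_def mult_single add.commute)
      then show ?thesis using a by (auto intro: ideal_gen_times ideal_gen_base)
    qed
    then show "f \<in> ideal_gen (mon ` A)"
      by (subst mpoly_sum_single[OF finite_keys subset_refl, of f]) (rule ideal_gen_sum)
  qed
qed

definition antichain :: "('n \<Rightarrow>\<^sub>0 nat) set \<Rightarrow> bool" where
  "antichain A \<longleftrightarrow> (\<forall>a\<in>A. \<forall>b\<in>A. a \<preceq> b \<longrightarrow> a = b)"

lemma antichain_same_degree: "(\<And>a. a \<in> A \<Longrightarrow> total_degree a = d) \<Longrightarrow> antichain A"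
  unfolding antichain_def using divides_total_degree_eq by metis

lemma minimal_generating_set_mon_iff:
  "minimal_generating_set (mon ` A) (monomial_ideal B :: ('n, 'k::field) mpoly set) \<longleftrightarrow>
     antichain A \<and> monomial_ideal A = (monomial_ideal B :: ('n, 'k) mpoly set)"
proof
  assume *: "minimal_generating_set (mon ` A) (monomial_ideal B :: ('n, 'k) mpoly set)"
  then have eq: "monomial_ideal A = (monomial_ideal B :: ('n, 'k) mpoly set)"
    by (simp add: minimal_generating_set_def ideal_gen_mon)
  have "antichain A" unfolding antichain_def
  proof (intro ballI impI, rule ccontr)
    fix a b assume ab: "a \<in> A" "b \<in> A" "a \<preceq> b" "a \<noteq> b"
    have "mon ` (A - {b}) \<subset> (mon ` A :: ('n, 'k) mpoly set)"
    proof
      have "mon b \<notin> (mon ` (A - {b}) :: ('n, 'k) mpoly set)" by auto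
      then show "mon ` (A - {b}) \<noteq> (mon ` A :: ('n, 'k) mpoly set)" using ab(2) by blast
    qed auto
    moreover have "monomial_ideal (A - {b}) = (monomial_ideal A :: ('n, 'k) mpoly set)"
    proof
      show "monomial_ideal A \<subseteq> (monomial_ideal (A - {b}) :: ('n, 'k) mpoly set)"
        unfolding monomial_ideal_subset_iff using ab divides_refl by blast
    qed (auto intro: monomial_ideal_mono[THEN subsetD])
    ultimately show False
      using * eq unfolding minimal_generating_set_def by (metis ideal_gen_mon)
  qed
  with eq show "antichain A \<and> monomial_ideal A = (monomial_ideal B :: ('n, 'k) mpoly set)" by simp
next
  assume *: "antichain A \<and> monomial_ideal A = (monomial_ideal B :: ('n, 'k) mpoly set)"
  show "minimal_generating_set (mon ` A) (monomial_ideal B :: ('n, 'k) mpoly set)"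
    unfolding minimal_generating_set_def
  proof (intro conjI allI impI notI)
    show "ideal_gen (mon ` A) = (monomial_ideal B :: ('n, 'k) mpoly set)"
      using * by (simp add: ideal_gen_mon)
    fix H :: "('n, 'k) mpoly set"
    assume H: "H \<subset> mon ` A" "ideal_gen H = monomial_ideal B"
    obtain C where C: "C \<subseteq> A" "H = mon ` C"
      using H(1) by (meson psubset_imp_subset subset_imageE)
    then obtain a where a: "a \<in> A" "a \<notin> C" using H(1) by blast
    have "monomial_ideal C = (monomial_ideal A :: ('n, 'k) mpoly set)"
      using * C H(2) by (simp add: ideal_gen_mon)
    then obtain c where "c \<in> C" "c \<preceq> a"
      using monomial_ideal_subset_iff[of A C] a by blast
    then show False using * a C(1) unfolding antichain_def by blast
  qed
qed

lemma antichain_unique: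
  assumes "antichain A" "antichain B"
      "monomial_ideal A = (monomial_ideal B :: ('n, 'k::field) mpoly set)"
  shows "A = B"
proof -
  have sub: "A \<subseteq> B" if "antichain A" and eq:
      "monomial_ideal A = (monomial_ideal B :: ('n, 'k) mpoly set)"
    for A B
  proof
    fix a assume a: "a \<in> A"
    then obtain b where b: "b \<in> B" "b \<preceq> a" using eq monomial_ideal_subset_iff by blast
    then obtain a' where a': "a' \<in> A" "a' \<preceq> b" using eq monomial_ideal_subset_iff by blast
    with a b that(1) have "a' = a" unfolding antichain_def by (metis divides_trans)
    then show "a \<in> B" using a' b divides_antisym by blast
  qed
  show ?thesis using sub assms by (metis subset_antisym)
qed

text \<open>The definite description in \<^const>\<open>min_mon_gens\<close> is met: an antichain of exponents is the
  only one that generates its monomial ideal.\<close>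

lemma min_mon_gens_monomial_ideal:
  assumes "antichain A"
  shows "min_mon_gens (monomial_ideal A) = (mon ` A :: ('n, 'k::field) mpoly set)"
  unfolding min_mon_gens_def
proof (rule the_equality)
  show "mon ` A \<subseteq> range mon \<and> minimal_generating_set (mon ` A)
      (monomial_ideal A :: ('n, 'k) mpoly set)"
    using assms by (auto simp: minimal_generating_set_mon_iff)
next
  fix G :: "('n, 'k) mpoly set"
  assume G: "G \<subseteq> range mon \<and> minimal_generating_set G (monomial_ideal A)"
  then obtain B where B: "G = mon ` B" by (meson subset_imageE)
  then show "G = mon ` A"
    using G assms antichain_unique by (metis minimal_generating_set_mon_iff)
qed

text \<open>Below every exponent there is a minimal one by induction on the degree.\<close>

lemma exists_antichain:
  assumes "finite B"
  shows "\<exists>A. A \<subseteq> B \<and> antichain A \<and> monomial_ideal A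
      = (monomial_ideal B :: ('n::finite, 'k::field) mpoly set)"
proof -
  define A where "A = {a \<in> B. \<forall>b\<in>B. b \<preceq> a \<longrightarrow> b = a}"
  have "\<exists>a\<in>A. a \<preceq> b" if "b \<in> B" for b
    using that
  proof (induction "total_degree b" arbitrary: b rule: less_induct)
    case less
    show ?case
    proof (cases "b \<in> A")
      case False
      then obtain c where c: "c \<in> B" "c \<preceq> b" "c \<noteq> b" using less by (auto simp: A_def)
      then have "total_degree c < total_degree b"
        using total_degree_mono divides_total_degree_eq le_neq_implies_less by metis
      then show ?thesis using less(1) c divides_trans by blast
    qed (auto intro: divides_refl)
  qed
  then have "monomial_ideal A = (monomial_ideal B :: ('n, 'k) mpoly set)"
    using monomial_ideal_subset_iff[of B A] monomial_ideal_mono[of A B] by (auto simp: A_def)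
  moreover have "antichain A" "A \<subseteq> B" by (auto simp: A_def antichain_def)
  ultimately show ?thesis by blast
qed

section \<open>Gradient ideals\<close>

lemma lookup_partial_deriv:
  fixes f :: "('n, 'k::field) mpoly"
  shows "lookup (partial_deriv i f) k = of_nat (Suc (lookup k i)) * lookup f (k + single i 1)"
proof -
  have "lookup (partial_deriv i f) k =
      (\<Sum>m\<in>keys f. if m = k + single i 1 then of_nat (lookup m i) * lookup f m else 0)"
    unfolding partial_deriv_def lookup_sum
  proof (rule sum.cong)
    fix m
    show "lookup (single (m - single i 1) (of_nat (lookup m i) * lookup f m)) k =
        (if m = k + single i 1 then of_nat (lookup m i) * lookup f m else 0)"
    proof (cases "lookup m i = 0")
      case False
      then have "single i 1 \<preceq> m" by (auto simp: divides_def lookup_single when_def)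
      then have "single i 1 + (m - single i 1) = m" by (rule divides_add_minus)
      then have "m - single i 1 = k \<longleftrightarrow> m = k + single i 1" by (auto simp: add.commute)
      then show ?thesis by (simp add: lookup_single)
    next
      case True
      then have "m \<noteq> k + single i 1" by (auto simp: lookup_add)
      then show ?thesis using True by simp
    qed
  qed simp
  also have "\<dots> = of_nat (Suc (lookup k i)) * lookup f (k + single i 1)"
    by (simp add: sum.delta lookup_add in_keys_iff)
  finally show ?thesis .
qed

lemma partial_deriv_add: "partial_deriv i (f + g) = partial_deriv i f + partial_deriv i g"
  by (rule poly_mapping_eqI) (simp add: lookup_partial_deriv lookup_add algebra_simps)

lemma partial_deriv_zero: "partial_deriv i 0 = 0"
  by (simp add: partial_deriv_def)

lemma partial_deriv_sum: "partial_deriv i (sum f S) = (\<Sum>x\<in>S. partial_deriv i (f x))"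
  by (induction S rule: infinite_finite_induct) (simp_all add: partial_deriv_add partial_deriv_zero)

lemma partial_deriv_single: "partial_deriv i (single a c)
    = single (a - single i 1) (of_nat (lookup a i) * c)"
  by (simp add: partial_deriv_def)

text \<open>The product rule is checked on coefficients. The truncated subtraction of exponents makes the
  cases in which \<open>x\<^sub>i\<close> does not divide a term different.\<close>

lemma partial_deriv_single_times:
  fixes f :: "('n, 'k::field) mpoly"
  shows "partial_deriv i (single a c * f)
      = partial_deriv i (single a c) * f + single a c * partial_deriv i f"
proof (rule poly_mapping_eqI)
  fix k
  let ?e = "single i 1 :: 'n \<Rightarrow>\<^sub>0 nat"
  show "lookup (partial_deriv i (single a c * f)) k =
    lookup (partial_deriv i (single a c) * f + single a c * partial_deriv i f) k"
  proof (cases "lookup a i = 0")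
    case True
    have "lookup a j \<le> lookup (k + ?e) j \<longleftrightarrow> lookup a j \<le> lookup k j" for j
      using True by (auto simp: lookup_add lookup_single when_def)
    then have iff: "a \<preceq> k + ?e \<longleftrightarrow> a \<preceq> k" by (simp add: divides_def)
    have "k + ?e - a = (k - a) + ?e" if "a \<preceq> k"
      using that True by (intro poly_mapping_eqI)
          (auto simp: lookup_add lookup_minus lookup_single when_def divides_def)
    then show ?thesis using True
      by (simp add: lookup_partial_deriv lookup_single_times lookup_add partial_deriv_single iff
          lookup_minus
        del: One_nat_def)
  next
    case False
    have "lookup a j \<le> lookup (k + ?e) j \<longleftrightarrow> lookup (a - ?e) j \<le> lookup k j" for j
      using False by (auto simp: lookup_add lookup_minus lookup_single when_def)
    then have iff: "a - ?e \<preceq> k \<longleftrightarrow> a \<preceq> k + ?e" by (simp add: divides_def)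
    have eq1: "k - (a - ?e) = k + ?e - a"
      using False by (intro poly_mapping_eqI)
          (auto simp: lookup_add lookup_minus lookup_single when_def)
    have eq2: "(k - a) + ?e = k + ?e - a" "lookup a i \<le> lookup k i" "a \<preceq> k + ?e" if "a \<preceq> k"
    proof -
      show "(k - a) + ?e = k + ?e - a"
        using that by (intro poly_mapping_eqI)
          (auto simp: lookup_add lookup_minus lookup_single when_def divides_def Suc_diff_le)
      show "lookup a i \<le> lookup k i" using that by (simp add: divides_def)
      show "a \<preceq> k + ?e" using that by (rule divides_trans) simp
    qed
    have eq3: "lookup a i = Suc (lookup k i)" if le: "a \<preceq> k + ?e" "\<not> a \<preceq> k"
    proof -
      obtain j where j: "\<not> lookup a j \<le> lookup k j" using le(2) by (auto simp: divides_def)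
      moreover have "lookup a j \<le> lookup (k + ?e) j" using le(1) by (simp add: divides_def)
      ultimately show ?thesis by (auto simp: lookup_add lookup_single when_def split: if_splits)
    qed
    show ?thesis
    proof (cases "a \<preceq> k")
      case True
      let ?F = "c * lookup f (k + ?e - a)"
      have L: "lookup (partial_deriv i (single a c * f)) k = of_nat (Suc (lookup k i)) * ?F"
        using eq2[OF True]
        by (simp add: lookup_partial_deriv lookup_single_times del: One_nat_def of_nat_Suc)
      have R: "lookup (partial_deriv i (single a c) * f + single a c * partial_deriv i f) k
          = of_nat (lookup a i) * ?F + of_nat (Suc (lookup k i - lookup a i)) * ?F"
        using True eq2[OF True]
        by (simp add: lookup_partial_deriv lookup_single_times lookup_add partial_deriv_single iff
            eq1
            lookup_minus del: One_nat_def of_nat_Suc)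
      have "of_nat (Suc (lookup k i))
          = (of_nat (lookup a i) + of_nat (Suc (lookup k i - lookup a i)) :: 'k)"
        using eq2(2)[OF True] by (simp flip: of_nat_add del: of_nat_Suc)
      then show ?thesis unfolding L R by (simp only: distrib_right)
    next
      case nd: False
      then show ?thesis using eq3
        by (simp add: lookup_partial_deriv lookup_single_times lookup_add partial_deriv_single iff
            eq1
            del: One_nat_def)
    qed
  qed
qed

lemma partial_deriv_times:
  fixes f g :: "('n, 'k::field) mpoly"
  shows "partial_deriv i (g * f) = partial_deriv i g * f + g * partial_deriv i f"
proof -
  have g: "g = (\<Sum>m\<in>keys g. single m (lookup g m))" by (rule mpoly_sum_single) auto
  have "partial_deriv i (g * f) = (\<Sum>m\<in>keys g. partial_deriv i (single m (lookup g m) * f))"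
    by (subst g) (simp add: sum_distrib_right partial_deriv_sum)
  also have "\<dots> = (\<Sum>m\<in>keys g. partial_deriv i (single m (lookup g m))) * f
      + (\<Sum>m\<in>keys g. single m (lookup g m)) * partial_deriv i f"
    by (simp add: partial_deriv_single_times sum.distrib sum_distrib_right)
  finally show ?thesis unfolding partial_deriv_sum[symmetric] g[symmetric] .
qed

lemma euler_homogeneous:
  fixes f :: "('n::finite, 'k::field) mpoly"
  assumes "homogeneous (int d) f"
  shows "(\<Sum>i\<in>UNIV. var i * partial_deriv i f) = single 0 (of_nat d) * f"
proof (rule poly_mapping_eqI)
  fix k
  have "lookup (var i * partial_deriv i f) k = of_nat (lookup k i) * lookup f k" for i
  proof (cases "lookup k i = 0")
    case True
    then have "\<not> single i 1 \<preceq> k" by (auto simp: divides_def intro!: exI[of _ i])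
    then show ?thesis using True by (simp add: var_def lookup_mon_times)
  next
    case False
    then have "single i 1 \<preceq> k" by (auto simp: divides_def lookup_single when_def)
    moreover from divides_add_minus[OF this] have "k - single i 1 + single i 1 = k"
      by (simp add: add.commute)
    ultimately show ?thesis using False
      by (simp add: var_def lookup_mon_times lookup_partial_deriv lookup_minus del: of_nat_Suc)
  qed
  then have "lookup (\<Sum>i\<in>UNIV. var i * partial_deriv i f) k = of_nat (total_degree k) * lookup f k"
    by (simp add: lookup_sum total_degree_def sum_distrib_right)
  also have "\<dots> = of_nat d * lookup f k"
    using assms by (cases "k \<in> keys f") (auto simp: homogeneous_iff in_keys_iff)
  finally show "lookup (\<Sum>i\<in>UNIV. var i * partial_deriv i f) k = lookup (single 0 (of_nat d) * f) k"
    by (simp add: lookup_single_times del: single_of_nat)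
qed

text \<open>By Euler's formula the ideal of the partial derivatives contains the generators
  themselves, so by the product rule it contains all derivatives of all elements of the ideal.\<close>

lemma derivatives_in_gradient:
  fixes G :: "('n::finite, 'k::field) mpoly set"
  assumes char: "CHAR('k) = 0" and G: "\<And>f. f \<in> G \<Longrightarrow> \<exists>d. homogeneous d f" "\<And>f. f \<in> G \<Longrightarrow> 0 \<notin> keys f"
    and f: "f \<in> ideal_gen G"
  shows "f \<in> ideal_gen {partial_deriv i f | i f. f \<in> G}" (is "_ \<in> ?Q")
    and "partial_deriv i f \<in> ideal_gen {partial_deriv i f | i f. f \<in> G}"
proof -
  have deriv: "partial_deriv i g \<in> ?Q" if "g \<in> G" for g i
    using that by (intro ideal_gen_base) blast
  have self: "g \<in> ?Q" if g: "g \<in> G" for g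
  proof (cases "g = 0")
    case True
    then show ?thesis by (simp add: ideal_gen_zero)
  next
    case False
    then obtain m where m: "m \<in> keys g"
      by (metis keys_zero poly_mapping_eqI in_keys_iff lookup_zero)
    obtain d where "homogeneous d g" using G(1)[OF g] by blast
    then have hom: "homogeneous (int (total_degree m)) g" using m by (simp add: homogeneous_iff)
    have "total_degree m \<noteq> 0" using G(2)[OF g] m total_degree_eq_0_iff by metis
    then have ne: "(of_nat (total_degree m) :: 'k) \<noteq> 0" using char
      by (simp add: of_nat_eq_0_iff_char_dvd)
    have "single 0 (inverse (of_nat (total_degree m))) * (single 0 (of_nat (total_degree m)) * g)
        = g"
      using ne by (simp add: mult_single del: single_of_nat flip: mult.assoc)
    then have "g = single 0 (inverse (of_nat (total_degree m))) *
        (\<Sum>i\<in>UNIV. var i * partial_deriv i g)"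
      by (simp add: euler_homogeneous[OF hom])
    also have "\<dots> \<in> ?Q" by (intro ideal_gen_times ideal_gen_sum deriv g)
    finally show ?thesis .
  qed
  have "ideal_gen G \<subseteq> {f. f \<in> ?Q \<and> (\<forall>i. partial_deriv i f \<in> ?Q)}"
    by (rule ideal_gen_subset)
      (auto simp: partial_deriv_add partial_deriv_zero partial_deriv_times
        intro: self deriv ideal_gen_zero ideal_gen_add ideal_gen_times
          ideal_gen_times[where g = "partial_deriv _ _"])
  then show "f \<in> ?Q" "partial_deriv i f \<in> ?Q" using f by auto
qed

text \<open>Hence the choice of a minimal generating set in the definition of the gradient ideal does not
  matter, and the monomial generators may be taken.\<close>

lemma gradient_independent:
  fixes G G' :: "('n::finite, 'k::field) mpoly set"
  assumes char: "CHAR('k) = 0" and eq: "ideal_gen G = ideal_gen G'"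
    and G: "\<And>f. f \<in> G \<Longrightarrow> \<exists>d. homogeneous d f" "\<And>f. f \<in> G \<Longrightarrow> 0 \<notin> keys f"
    and G': "\<And>f. f \<in> G' \<Longrightarrow> \<exists>d. homogeneous d f" "\<And>f. f \<in> G' \<Longrightarrow> 0 \<notin> keys f"
  shows "ideal_gen {partial_deriv i f | i f. f \<in> G} = ideal_gen {partial_deriv i f | i f. f \<in> G'}"
proof -
  have sub: "ideal_gen {partial_deriv i f | i f. f \<in> A}
      \<subseteq> ideal_gen {partial_deriv i f | i f. f \<in> B}"
    if "ideal_gen A = ideal_gen B" "\<And>f. f \<in> B \<Longrightarrow> \<exists>d. homogeneous d f" "\<And>f. f \<in> B \<Longrightarrow> 0 \<notin> keys f"
    for A B :: "('n, 'k) mpoly set"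
  proof (rule ideal_gen_subset)
    show "{partial_deriv i f | i f. f \<in> A} \<subseteq> ideal_gen {partial_deriv i f | i f. f \<in> B}"
      using derivatives_in_gradient(2)[OF char that(2,3)] ideal_gen_base[of _ A] that(1) by auto
  qed (auto intro: ideal_gen_zero ideal_gen_add ideal_gen_times)
  show ?thesis
    by (intro equalityI sub[OF eq G'] sub[OF eq[symmetric] G])
qed

text \<open>The exponents of the monomials \<open>u / x\<^sub>i\<close>.\<close>

definition quotient_exponents :: "('n \<Rightarrow>\<^sub>0 nat) set \<Rightarrow> ('n \<Rightarrow>\<^sub>0 nat) set" where
  "quotient_exponents A = {b. \<exists>i. single i 1 + b \<in> A}"

lemma monomial_gradient_eq:
  assumes "antichain A"
  shows "monomial_gradient (monomial_ideal A)
      = (monomial_ideal (quotient_exponents A) :: ('n, 'k::field) mpoly set)"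
proof -
  have "{v. \<exists>u\<in>mon ` A. \<exists>i. u = var i * v} = (mon ` quotient_exponents A :: ('n, 'k) mpoly set)"
  proof (intro equalityI subsetI)
    fix v :: "('n, 'k) mpoly" assume "v \<in> {v. \<exists>u\<in>mon ` A. \<exists>i. u = var i * v}"
    then obtain a i where a: "a \<in> A" "mon a = mon (single i 1) * v" by (auto simp: var_def)
    have "a \<in> (+) (single i 1) ` keys v"
      using arg_cong[OF a(2), of keys] by (auto simp: keys_mon_times)
    then obtain b where b: "a = single i 1 + b" by blast
    then have "mon (single i 1) * mon b = mon (single i 1) * v" using a(2) by (simp add: mon_add)
    then have "v = mon b" by (simp add: mon_times_cancel)
    then show "v \<in> mon ` quotient_exponents A" using a(1) b by (auto simp: quotient_exponents_def)
  next
    fix v :: "('n, 'k) mpoly" assume "v \<in> mon ` quotient_exponents A"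
    then obtain b i where "v = mon b" "single i 1 + b \<in> A" by (auto simp: quotient_exponents_def)
    then show "v \<in> {v. \<exists>u\<in>mon ` A. \<exists>i. u = var i * v}"
      by (auto simp: var_def simp flip: mon_add intro!: exI[of _ i])
  qed
  then show ?thesis
    by (simp add: monomial_gradient_def min_mon_gens_monomial_ideal[OF assms] ideal_gen_mon)
qed

lemma gradient_ideal_eq:
  fixes A :: "('n::finite \<Rightarrow>\<^sub>0 nat) set"
  assumes char: "CHAR('k::field) = 0" and A: "antichain A" "0 \<notin> A"
  shows "gradient_ideal (monomial_ideal A)
      = (monomial_ideal (quotient_exponents A) :: ('n, 'k) mpoly set)"
proof -
  let ?I = "monomial_ideal A :: ('n, 'k) mpoly set"
  define G where "G = (SOME G. minimal_homogeneous_generating_set G ?I)"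
  have "minimal_homogeneous_generating_set (mon ` A) ?I"
    using A(1) by (auto simp: minimal_homogeneous_generating_set_def
        minimal_generating_set_mon_iff homogeneous_mon)
  then have "minimal_homogeneous_generating_set G ?I" unfolding G_def by (rule someI)
  then have G: "\<And>f. f \<in> G \<Longrightarrow> \<exists>d. homogeneous d f" "ideal_gen G = ?I"
    by (auto simp: minimal_homogeneous_generating_set_def minimal_generating_set_def)
  have "0 \<notin> keys f" if f: "f \<in> ?I" for f
  proof
    assume "0 \<in> keys f"
    then obtain a where "a \<in> A" "a \<preceq> 0" using f by (auto simp: monomial_ideal_def)
    with A(2) show False using divides_antisym[of a 0] by auto
  qed
  then have "\<And>f. f \<in> G \<Longrightarrow> 0 \<notin> keys f" "\<And>f. f \<in> (mon ` A :: ('n, 'k) mpoly set) \<Longrightarrow> 0 \<notin> keys f"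
    using ideal_gen_base[of _ G] G(2) mon_in_monomial_ideal[of _ A] by auto
  then have "gradient_ideal ?I = ideal_gen {partial_deriv i f | i f. f \<in>
      (mon ` A :: ('n, 'k) mpoly set)}"
    unfolding gradient_ideal_def G_def[symmetric]
    using G by (intro gradient_independent[OF char]) (auto simp: ideal_gen_mon homogeneous_mon)
  also have "\<dots> = monomial_ideal (quotient_exponents A)"
  proof
    have "partial_deriv i (mon a) \<in> (monomial_ideal (quotient_exponents A) :: ('n, 'k) mpoly set)"
        if "a \<in> A" for i a
    proof (cases "lookup a i = 0")
      case True
      then show ?thesis by (simp add: mon_def partial_deriv_single)
    next
      case False
      then have "single i 1 \<preceq> a" by (auto simp: divides_def lookup_single when_def)
      then have "a - single i 1 \<in> quotient_exponents A"
        using that by (auto simp: quotient_exponents_def divides_add_minus intro!: exI[of _ i])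
      then show ?thesis by (auto simp: mon_def partial_deriv_single monomial_ideal_def)
    qed
    then show "ideal_gen {partial_deriv i f | i f. f \<in> (mon ` A :: ('n, 'k) mpoly set)}
        \<subseteq> monomial_ideal (quotient_exponents A)"
      by (intro ideal_gen_subset) (auto intro: monomial_ideal_add monomial_ideal_times)
  next
    have "mon b \<in> ideal_gen {partial_deriv i f | i f. f \<in> (mon ` A :: ('n, 'k) mpoly set)}"
      if b: "b \<in> quotient_exponents A" for b
    proof -
      obtain i where i: "single i 1 + b \<in> A" using b by (auto simp: quotient_exponents_def)
      let ?c = "of_nat (Suc (lookup b i)) :: 'k"
      have c: "?c \<noteq> 0" using char by (simp add: of_nat_eq_0_iff_char_dvd del: of_nat_Suc)
      have "partial_deriv i (mon (single i 1 + b)) = single b ?c"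
        by (simp add: mon_def partial_deriv_single lookup_add)
      then have "single b ?c \<in> ideal_gen {partial_deriv i f | i f. f \<in>
          (mon ` A :: ('n, 'k) mpoly set)}"
        using i by (intro ideal_gen_base) (metis (mono_tags, lifting) imageI mem_Collect_eq)
      then have "single 0 (inverse ?c) * single b ?c
          \<in> ideal_gen {partial_deriv i f | i f. f \<in> (mon ` A :: ('n, 'k) mpoly set)}"
        by (rule ideal_gen_times)
      then show ?thesis using c by (simp add: mult_single mon_def del: of_nat_Suc)
    qed
    then show "monomial_ideal (quotient_exponents A)
        \<subseteq> ideal_gen {partial_deriv i f | i f. f \<in> (mon ` A :: ('n, 'k) mpoly set)}"
      unfolding ideal_gen_mon[symmetric]
      by (intro ideal_gen_subset) (auto intro: ideal_gen_zero ideal_gen_add ideal_gen_times)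
  qed
  finally show ?thesis .
qed

section \<open>Vanishing of Tor\<close>

text \<open>
  The definition of \<^const>\<open>tor_dim\<close> refers to an unspecified resolution, so everything below is shown
  for an arbitrary one.
\<close>

locale field_resolution =
  fixes F :: "('n::finite, 'k::field) free_complex"
  assumes resolution: "graded_free_resolution_of_field F"
begin

lemma homogeneous_mat:
  "r < rk F p \<Longrightarrow> c < rk F (Suc p) \<Longrightarrow> homogeneous (shift F (Suc p) c - shift F p r) (mat F p r c)"
  using resolution by (simp add: graded_free_resolution_of_field_def)

lemma shift_aug: "c < rk F 0 \<Longrightarrow> aug F c \<noteq> 0 \<Longrightarrow> shift F 0 c = 0"
  using resolution by (simp add: graded_free_resolution_of_field_def)

lemma augmentation_surj: "augmentation F ` chains F UNIV 0 = UNIV"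
  using resolution by (simp add: graded_free_resolution_of_field_def)

lemma augmentation_unit:
  obtains c0 where "c0 < rk F 0" "aug F c0 \<noteq> 0"
proof -
  obtain v where v: "augmentation F v = 1" using augmentation_surj by (metis UNIV_I image_iff)
  have "\<exists>c<rk F 0. aug F c \<noteq> 0"
  proof (rule ccontr)
    assume "\<not> ?thesis"
    then have "augmentation F v = 0" by (simp add: augmentation_def)
    with v show False by simp
  qed
  then show thesis using that by blast
qed

lemma exact_augmentation: "{v \<in> chains F UNIV 0. augmentation F v = 0} = boundaries F UNIV 0"
  using resolution by (simp add: graded_free_resolution_of_field_def)

lemma exact: "cycles F UNIV (Suc p) = boundaries F UNIV (Suc p)"
  using resolution by (simp add: graded_free_resolution_of_field_def)

lemma chains_mono: "I \<subseteq> J \<Longrightarrow> v \<in> chains F I p \<Longrightarrow> v \<in> chains F J p"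
  by (auto simp: chains_def)

lemma chains_add:
  "v \<in> chains F (monomial_ideal A) p \<Longrightarrow> w \<in> chains F (monomial_ideal A) p
      \<Longrightarrow> v + w \<in> chains F (monomial_ideal A) p"
  by (auto simp: chains_def intro: monomial_ideal_add)

lemma chains_diff:
  "v \<in> chains F (monomial_ideal A) p \<Longrightarrow> w \<in> chains F (monomial_ideal A) p
      \<Longrightarrow> v - w \<in> chains F (monomial_ideal A) p"
  by (auto simp: chains_def intro: monomial_ideal_diff)

lemma chains_deg_add: "v \<in> chains_deg F p j \<Longrightarrow> w \<in> chains_deg F p j \<Longrightarrow> v + w \<in> chains_deg F p j"
  by (auto simp: chains_deg_def intro: homogeneous_add)

lemma chains_deg_diff: "v \<in> chains_deg F p j \<Longrightarrow> w \<in> chains_deg F p j \<Longrightarrow> v - w \<in> chains_deg F p j"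
  by (auto simp: chains_deg_def intro: homogeneous_diff)

lemma boundary_map_add: "boundary_map F p (v + w) = boundary_map F p v + boundary_map F p w"
  by (auto simp: boundary_map_def fun_eq_iff distrib_left sum.distrib)

lemma boundary_map_diff: "boundary_map F p (v - w) = boundary_map F p v - boundary_map F p w"
  by (auto simp: boundary_map_def fun_eq_iff right_diff_distrib sum_subtractf)

lemma boundary_map_scale: "boundary_map F p (\<lambda>c. g * v c) = (\<lambda>c. g * boundary_map F p v c)"
  by (auto simp: boundary_map_def fun_eq_iff sum_distrib_left algebra_simps)

lemma boundary_map_chains:
  "v \<in> chains F (monomial_ideal A) (Suc p) \<Longrightarrow> boundary_map F p v \<in> chains F (monomial_ideal A) p"
  by (auto simp: chains_def boundary_map_def intro!: monomial_ideal_sum monomial_ideal_times)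

lemma boundary_map_boundary_map:
  assumes "v \<in> chains F I (Suc (Suc p))"
  shows "boundary_map F p (boundary_map F (Suc p) v) = 0"
proof -
  have "boundary_map F (Suc p) v \<in> boundaries F UNIV (Suc p)"
    using assms by (auto simp: boundaries_def chains_def)
  then show ?thesis unfolding exact[symmetric] by (simp add: cycles_def)
qed

lemma augmentation_boundary_map:
  assumes "v \<in> chains F I (Suc 0)"
  shows "augmentation F (boundary_map F 0 v) = 0"
proof -
  have "boundary_map F 0 v \<in> boundaries F UNIV 0"
    using assms by (auto simp: boundaries_def chains_def)
  then show ?thesis unfolding exact_augmentation[symmetric] by simp
qed

lemma boundary_map_deg:
  assumes "v \<in> chains_deg F (Suc p) j"
  shows "boundary_map F p v \<in> chains_deg F p j"
proof -
  have "homogeneous (j - shift F p r) (\<Sum>c<rk F (Suc p). mat F p r c * v c)"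
    if "r < rk F p" for r
  proof -
    have "homogeneous (j - shift F p r) (mat F p r c * v c)" if "c < rk F (Suc p)" for c
      using homogeneous_mult[OF homogeneous_mat[OF \<open>r < rk F p\<close> that]] assms that
      by (fastforce simp: chains_deg_def)
    then show ?thesis by (intro homogeneous_sum) auto
  qed
  then show ?thesis by (auto simp: chains_deg_def boundary_map_def)
qed

lemma boundaries_subset_cycles: "boundaries F (monomial_ideal A) p \<subseteq> cycles F (monomial_ideal A) p"
  by (auto simp: boundaries_def cycles_def boundary_map_chains boundary_map_boundary_map
      split: nat.splits)

text \<open>The boundary map commutes with passing to homogeneous components.\<close>

lemma homogeneous_boundary:
  assumes "z \<in> boundaries F (monomial_ideal A) p" "z \<in> chains_deg F p j"
  obtains y where "y \<in> chains F (monomial_ideal A) (Suc p)" "y \<in> chains_deg F (Suc p) j"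
    "z = boundary_map F p y"
proof -
  obtain x where x: "x \<in> chains F (monomial_ideal A) (Suc p)" "z = boundary_map F p x"
    using assms(1) by (auto simp: boundaries_def)
  define y where "y = (\<lambda>c. hom_comp (j - shift F (Suc p) c) (x c))"
  have "y \<in> chains F (monomial_ideal A) (Suc p)"
    using x(1) by (auto simp: y_def chains_def hom_comp_def restrict_keys_monomial_ideal)
  moreover have "y \<in> chains_deg F (Suc p) j"
    by (simp add: y_def chains_deg_def homogeneous_hom_comp)
  moreover have "z r = boundary_map F p y r" for r
  proof (cases "r < rk F p")
    case True
    have "z r = hom_comp (j - shift F p r) (z r)"
      using True assms(2) by (simp add: chains_deg_def hom_comp_homogeneous)
    also have "\<dots> = hom_comp (j - shift F p r) (\<Sum>c<rk F (Suc p). mat F p r c * x c)"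
      using True x(2) by (simp add: boundary_map_def)
    also have "\<dots> = (\<Sum>c<rk F (Suc p). hom_comp (j - shift F p r) (mat F p r c * x c))"
      by (simp add: hom_comp_def restrict_keys_sum)
    also have "\<dots> = (\<Sum>c<rk F (Suc p). mat F p r c * y c)"
    proof (rule sum.cong)
      fix c assume "c \<in> {..<rk F (Suc p)}"
      then show "hom_comp (j - shift F p r) (mat F p r c * x c) = mat F p r c * y c"
        using hom_comp_times[OF homogeneous_mat[OF True, of c], of "j - shift F (Suc p) c" "x c"]
        by (simp add: y_def)
    qed simp
    finally show ?thesis using True by (simp add: boundary_map_def)
  next
    case False
    then show ?thesis using x(2) by (simp add: boundary_map_def)
  qed
  ultimately show thesis using that by blast
qed

definition tor_vanishes :: "('n, 'k) mpoly set \<Rightarrow> nat \<Rightarrow> int \<Rightarrow> bool" where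
  "tor_vanishes I i j \<longleftrightarrow> cycles F I i \<inter> chains_deg F i j \<subseteq> boundaries F I i"

lemma tor_vanishes_zero: "tor_vanishes (monomial_ideal {}) i j"
proof -
  have "v = boundary_map F i 0" "0 \<in> chains F {0} (Suc i)" if "v \<in> cycles F {0} i" for v
    using that
    by (auto simp: cycles_def chains_def boundary_map_def fun_eq_iff not_less intro: sum.neutral)
  then show ?thesis unfolding tor_vanishes_def monomial_ideal_empty boundaries_def by blast
qed

text \<open>\<open>Tor\<^sub>i(K, S)\<close> is zero except for \<open>K\<close> in position and degree \<open>0\<close>: in another degree the
  augmentation of a chain vanishes.\<close>

lemma tor_vanishes_UNIV:
  assumes "j \<noteq> int i"
  shows "tor_vanishes UNIV i j"
proof (cases i)
  case 0
  have "augmentation F v = 0" if "v \<in> chains_deg F 0 j" for v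
    unfolding augmentation_def
  proof (intro sum.neutral ballI)
    fix c assume c: "c \<in> {..<rk F 0}"
    show "aug F c * lookup (v c) 0 = 0"
    proof (cases "aug F c = 0")
      case False
      then have "homogeneous j (v c)"
        using that c shift_aug[of c] by (auto simp: chains_deg_def)
      then have "0 \<notin> keys (v c)" using assms 0 by (auto simp: homogeneous_iff)
      then show ?thesis by (simp add: in_keys_iff)
    qed simp
  qed
  then show ?thesis
    unfolding tor_vanishes_def 0 exact_augmentation[symmetric] by (auto simp: cycles_def)
next
  case (Suc q)
  then show ?thesis unfolding tor_vanishes_def Suc using exact by blast
qed

lemma chains_translate:
  assumes "z \<in> chains F (monomial_ideal ((+) u ` A)) p"
  obtains y where "y \<in> chains F (monomial_ideal A) p" "z = (\<lambda>c. mon u * y c)"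
proof
  define y where "y = (\<lambda>c. if c < rk F p then SOME f. z c = mon u * f
      \<and> f \<in> monomial_ideal A else 0)"
  have y: "z c = mon u * y c \<and> y c \<in> monomial_ideal A" if "c < rk F p" for c
  proof -
    have "\<exists>f. z c = mon u * f \<and> f \<in> monomial_ideal A"
      using assms that by (auto simp: chains_def monomial_ideal_translate)
    then show ?thesis using that by (simp add: y_def) (rule someI_ex)
  qed
  then show "y \<in> chains F (monomial_ideal A) p" by (simp add: chains_def) (simp add: y_def)
  have "z c = mon u * y c" for c
    using y assms by (cases "c < rk F p") (auto simp: chains_def y_def)
  then show "z = (\<lambda>c. mon u * y c)" by blast
qed

text \<open>Multiplication by a monomial \<open>u\<close> is an isomorphism from \<open>I\<close> to \<open>u I\<close> that shifts degrees.\<close>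

lemma tor_vanishes_translate:
  assumes "tor_vanishes (monomial_ideal A) i (j - int (total_degree u))"
  shows "tor_vanishes (monomial_ideal ((+) u ` A)) i j"
  unfolding tor_vanishes_def
proof
  fix z assume z: "z \<in> cycles F (monomial_ideal ((+) u ` A)) i \<inter> chains_deg F i j"
  then obtain y where y: "y \<in> chains F (monomial_ideal A) i" and z_eq: "z = (\<lambda>c. mon u * y c)"
    using chains_translate unfolding cycles_def by blast
  have "y \<in> cycles F (monomial_ideal A) i"
  proof (cases i)
    case (Suc q)
    have "boundary_map F q z = 0" using z Suc by (simp add: cycles_def)
    then have "mon u * boundary_map F q y c = mon u * 0" for c
      unfolding z_eq boundary_map_scale by (simp add: fun_eq_iff)
    then have "boundary_map F q y = 0" unfolding mon_times_cancel by (simp add: fun_eq_iff)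
    then show ?thesis using y Suc by (simp add: cycles_def)
  qed (use y in \<open>simp add: cycles_def\<close>)
  moreover have "y \<in> chains_deg F i (j - int (total_degree u))"
    using z by (auto simp: chains_deg_def z_eq homogeneous_mon_times algebra_simps)
  ultimately have "y \<in> boundaries F (monomial_ideal A) i"
    using assms unfolding tor_vanishes_def by blast
  then obtain x where x: "x \<in> chains F (monomial_ideal A) (Suc i)" "y = boundary_map F i x"
    by (auto simp: boundaries_def)
  have "z = boundary_map F i (\<lambda>c. mon u * x c)"
    by (simp add: z_eq x(2) boundary_map_scale)
  moreover have "(\<lambda>c. mon u * x c) \<in> chains F (monomial_ideal ((+) u ` A)) (Suc i)"
    using x(1) by (auto simp: chains_def monomial_ideal_translate)
  ultimately show "z \<in> boundaries F (monomial_ideal ((+) u ` A)) i"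
    by (auto simp: boundaries_def)
qed

lemma split_chain:
  assumes "z \<in> chains F (monomial_ideal (A \<union> B)) p"
  obtains a b where "a \<in> chains F (monomial_ideal A) p" "b \<in> chains F (monomial_ideal B) p"
      "z = a + b"
    "\<And>j. z \<in> chains_deg F p j \<Longrightarrow> a \<in> chains_deg F p j \<and> b \<in> chains_deg F p j"
proof
  let ?P = "\<lambda>m. \<exists>a\<in>A. a \<preceq> m"
  show "(\<lambda>c. restrict_keys ?P (z c)) \<in> chains F (monomial_ideal A) p"
    "(\<lambda>c. restrict_keys (\<lambda>m. \<not> ?P m) (z c)) \<in> chains F (monomial_ideal B) p"
    using assms unfolding chains_def
      by (auto simp del: bex_simps intro!: monomial_ideal_union_split)
  show "z = (\<lambda>c. restrict_keys ?P (z c)) + (\<lambda>c. restrict_keys (\<lambda>m. \<not> ?P m) (z c))"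
    unfolding plus_fun_def restrict_keys_split ..
  show "(\<lambda>c. restrict_keys ?P (z c)) \<in> chains_deg F p j \<and>
      (\<lambda>c. restrict_keys (\<lambda>m. \<not> ?P m) (z c)) \<in> chains_deg F p j" if "z \<in> chains_deg F p j" for j
    using that by (auto simp: chains_deg_def intro: homogeneous_restrict_keys)
qed

text \<open>
  This is the exactness of
  \<open>Tor\<^sub>i(K, I) \<oplus> Tor\<^sub>i(K, J) \<rightarrow> Tor\<^sub>i(K, I + J) \<rightarrow> Tor\<^sub>i\<^sub>-\<^sub>1(K, I \<inter> J)\<close> in the middle.
\<close>

lemma tor_vanishes_union:
  assumes A: "tor_vanishes (monomial_ideal A) i j" and B: "tor_vanishes (monomial_ideal B) i j"
    and C: "monomial_ideal A \<inter> monomial_ideal B = (monomial_ideal C :: ('n, 'k) mpoly set)"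
      "\<And>q. i = Suc q \<Longrightarrow> tor_vanishes (monomial_ideal C) q j"
  shows "tor_vanishes (monomial_ideal (A \<union> B)) i j"
  unfolding tor_vanishes_def
proof
  fix z assume z: "z \<in> cycles F (monomial_ideal (A \<union> B)) i \<inter> chains_deg F i j"
  then obtain a b where ab: "a \<in> chains F (monomial_ideal A) i"
      "b \<in> chains F (monomial_ideal B) i" "z = a + b"
    "a \<in> chains_deg F i j" "b \<in> chains_deg F i j"
  proof -
    have "z \<in> chains F (monomial_ideal (A \<union> B)) i" using z by (simp add: cycles_def)
    from split_chain[OF this] z that show ?thesis by blast
  qed
  have sub: "monomial_ideal A \<subseteq> (monomial_ideal (A \<union> B) :: ('n, 'k) mpoly set)"
    "monomial_ideal B \<subseteq> (monomial_ideal (A \<union> B) :: ('n, 'k) mpoly set)"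
      by (auto intro: monomial_ideal_mono[THEN subsetD])
  \<comment> \<open>It suffices to correct the summands of the cycle to cycles.\<close>
  have "\<exists>e. e \<in> chains F (monomial_ideal C) i \<and> e \<in> chains_deg F i j \<and>
      a - e \<in> cycles F (monomial_ideal A) i \<and> b + e \<in> cycles F (monomial_ideal B) i"
  proof (cases i)
    case 0
    have "0 \<in> chains F (monomial_ideal C) i" "0 \<in> chains_deg F i j"
        "a - 0 \<in> cycles F (monomial_ideal A) i"
      "b + 0 \<in> cycles F (monomial_ideal B) i"
      using 0 ab by (auto simp: chains_def chains_deg_def cycles_def)
    then show ?thesis by blast
  next
    case (Suc q)
    let ?c = "boundary_map F q a"
    have bd: "boundary_map F q a + boundary_map F q b = 0"
      using z ab(3) Suc by (simp add: cycles_def boundary_map_add)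
    then have eq: "boundary_map F q b = - ?c"
      by (simp add: eq_neg_iff_add_eq_0 add.commute)
    have "?c \<in> chains F (monomial_ideal A) q" "boundary_map F q b \<in> chains F (monomial_ideal B) q"
      using ab Suc by (auto intro: boundary_map_chains)
    then have "?c \<in> chains F (monomial_ideal C) q"
      unfolding C(1)[symmetric] chains_def eq by (auto simp: monomial_ideal_uminus)
    moreover have "?c \<in> chains_deg F q j" using ab(4) Suc by (auto intro: boundary_map_deg)
    moreover have "case q of 0 \<Rightarrow> True | Suc r \<Rightarrow> boundary_map F r ?c = 0"
      using ab(1) Suc by (auto split: nat.splits intro: boundary_map_boundary_map)
    ultimately have "?c \<in> boundaries F (monomial_ideal C) q"
      using C(2)[OF Suc] by (auto simp: tor_vanishes_def cycles_def)
    then obtain e where e: "e \<in> chains F (monomial_ideal C) i" "e \<in> chains_deg F i j"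
        "?c = boundary_map F q e"
      using homogeneous_boundary[of ?c C q j] \<open>?c \<in> chains_deg F q j\<close> Suc by metis
    have "e \<in> chains F (monomial_ideal A) i" "e \<in> chains F (monomial_ideal B) i"
      using e(1) C(1) by (auto simp: chains_def)
    then have "a - e \<in> cycles F (monomial_ideal A) i" "b + e \<in> cycles F (monomial_ideal B) i"
      using Suc ab e(3) eq
      by (auto simp: cycles_def chains_diff chains_add boundary_map_diff boundary_map_add)
    with e show ?thesis by blast
  qed
  then obtain e where e: "e \<in> chains_deg F i j" "a - e \<in> cycles F (monomial_ideal A) i"
    "b + e \<in> cycles F (monomial_ideal B) i" by blast
  then have "a - e \<in> boundaries F (monomial_ideal A) i" "b + e \<in> boundaries F (monomial_ideal B) i"
    using A B ab chains_deg_add chains_deg_diff unfolding tor_vanishes_def by blast+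
  then obtain x y where "x \<in> chains F (monomial_ideal A) (Suc i)" "a - e = boundary_map F i x"
    "y \<in> chains F (monomial_ideal B) (Suc i)" "b + e = boundary_map F i y"
    by (auto simp: boundaries_def)
  moreover have "z = (a - e) + (b + e)" by (simp add: ab(3))
  ultimately have "z = boundary_map F i (x + y)" "x + y \<in> chains F (monomial_ideal (A \<union> B)) (Suc i)"
    using sub by (auto simp: boundary_map_add intro!: chains_add intro: chains_mono)
  then show "z \<in> boundaries F (monomial_ideal (A \<union> B)) i" by (auto simp: boundaries_def)
qed

subsection \<open>Boundedness and linearity\<close>

lemma tor_vanishes_principal:
  assumes "j \<noteq> int i + int (total_degree u)"
  shows "tor_vanishes (monomial_ideal {u}) i j"
  using tor_vanishes_translate[of "{0}" i j u] tor_vanishes_UNIV[of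
      "j - int (total_degree u)" i] assms
  by (simp add: monomial_ideal_zero_exponent algebra_simps)

text \<open>This is \<open>I \<inter> (u) = u (I : u)\<close>; the truncated difference \<open>a - u\<close> is the exponent of
  \<open>lcm(a, u) / u\<close>.\<close>

lemma monomial_ideal_Int_principal:
  "monomial_ideal A \<inter> monomial_ideal {u}
      = (monomial_ideal ((+) u ` (\<lambda>a. a - u) ` A) :: ('n, 'k) mpoly set)"
proof -
  have "u + (a - u) \<preceq> m \<longleftrightarrow> a \<preceq> m \<and> u \<preceq> m" for a m :: "'n \<Rightarrow>\<^sub>0 nat"
  proof -
    have "lookup u i + (lookup a i - lookup u i) \<le> lookup m i \<longleftrightarrow>
        lookup a i \<le> lookup m i \<and> lookup u i \<le> lookup m i" for i by arith
    then show ?thesis by (simp add: divides_def lookup_add lookup_minus) blast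
  qed
  then show ?thesis by (auto simp: monomial_ideal_def)
qed

text \<open>
  The maximum in the definition of the regularity is meaningful because it ranges over a finite
  set. Generators are added one at a time; the colon ideal by the new generator needs no more
  generators than the old ideal.
\<close>

lemma tor_bounded:
  "finite A \<Longrightarrow> \<exists>R. finite R \<and> (\<forall>i j. j - int i \<notin> R \<longrightarrow> tor_vanishes (monomial_ideal A) i j)"
proof (induction "card A" arbitrary: A rule: less_induct)
  case less
  show ?case
  proof (cases "A = {}")
    case True
    then show ?thesis using tor_vanishes_zero by auto
  next
    case False
    then obtain u B where u: "A = insert u B" "u \<notin> B" by (meson Set.set_insert ex_in_conv)
    then have B: "finite B" "card B < card A" using less(2) by auto
    let ?C = "(\<lambda>a. a - u) ` B"
    have "finite ?C" "card ?C < card A" using B card_image_le[of B "\<lambda>a. a - u"] by auto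
    then obtain R' where R': "finite R'"
        "\<And>i j. j - int i \<notin> R' \<Longrightarrow> tor_vanishes (monomial_ideal ?C) i j"
      using less(1)[of ?C] by auto
    obtain R where R: "finite R" "\<And>i j. j - int i \<notin> R \<Longrightarrow> tor_vanishes (monomial_ideal B) i j"
      using less(1)[of B] B by auto
    let ?R = "R \<union> {int (total_degree u)} \<union> (\<lambda>r. r + int (total_degree u) - 1) ` R'"
    have "tor_vanishes (monomial_ideal A) i j" if "j - int i \<notin> ?R" for i j
    proof -
      have "tor_vanishes (monomial_ideal (B \<union> {u})) i j"
      proof (rule tor_vanishes_union[OF _ _ monomial_ideal_Int_principal])
        fix q assume q: "i = Suc q"
        have "j - int (total_degree u) - int q \<notin> R'"
          using that q by (force simp: algebra_simps image_iff)
        then show "tor_vanishes (monomial_ideal ((+) u ` ?C)) q j"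
          by (intro tor_vanishes_translate R'(2))
      qed (use that R in \<open>auto intro!: tor_vanishes_principal\<close>)
      then show ?thesis using u by simp
    qed
    then show ?thesis using R(1) R'(1) by (intro exI[of _ ?R]) auto
  qed
qed

definition linear_tor :: "nat \<Rightarrow> ('n, 'k) mpoly set \<Rightarrow> bool" where
  "linear_tor d I \<longleftrightarrow> (\<forall>i j. j \<noteq> int i + int d \<longrightarrow> tor_vanishes I i j)"

text \<open>
  Generators survive in \<open>Tor\<^sub>0\<close>. The augmentation, applied to the coefficients at the monomial \<open>m\<close>,
  kills all boundaries but not the generator \<open>m\<close>.
\<close>

lemma not_tor_vanishes_zero:
  assumes A: "\<And>a. a \<in> A \<Longrightarrow> total_degree a = d" and m: "m \<in> A"
  shows "\<not> tor_vanishes (monomial_ideal A) 0 (int d)"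
proof
  assume *: "tor_vanishes (monomial_ideal A) 0 (int d)"
  obtain c0 where c0: "c0 < rk F 0" "aug F c0 \<noteq> 0" by (rule augmentation_unit)
  define z where "z = (\<lambda>c. if c = c0 then mon m else (0 :: ('n, 'k) mpoly))"
  have "z \<in> cycles F (monomial_ideal A) 0 \<inter> chains_deg F 0 (int d)"
    using c0 m A by (auto simp: z_def cycles_def chains_def chains_deg_def shift_aug
        homogeneous_mon intro: mon_in_monomial_ideal)
  then obtain y where y: "y \<in> chains F (monomial_ideal A) (Suc 0)" "z = boundary_map F 0 y"
    using * unfolding tor_vanishes_def by (auto simp: boundaries_def)
  \<comment> \<open>The coefficients at \<open>m\<close> see only the constant terms of the matrix entries, because the
     ideal vanishes in degrees below \<open>d\<close>.\<close>
  have coeff: "lookup (g * f) m = lookup g 0 * lookup f m" if f: "f \<in> monomial_ideal A" for f g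
  proof -
    have "lookup (single l (lookup g l) * f) m = (if l = 0 then lookup g 0 * lookup f m else 0)"
        for l
    proof (cases "l = 0 \<or> \<not> l \<preceq> m")
      case False
      then have "m - l \<notin> keys f"
      proof -
        have "total_degree (m - l) < d"
          using False A[OF m] total_degree_add[of l "m - l"] total_degree_eq_0_iff[of l]
          by (auto simp: divides_add_minus)
        then show ?thesis using f A total_degree_mono by (fastforce simp: monomial_ideal_def)
      qed
      then show ?thesis using False by (simp add: lookup_single_times in_keys_iff)
    next
      case True
      then show ?thesis by (auto simp: lookup_single_times)
    qed
    then show ?thesis
      by (subst mpoly_sum_single[OF finite_keys subset_refl, of g])
        (simp add: sum_distrib_right lookup_sum sum.delta' in_keys_iff)
  qed
  define w where "w = (\<lambda>c. single 0 (lookup (y c) m) :: ('n, 'k) mpoly)"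
  have "w \<in> chains F UNIV (Suc 0)" using y(1) by (auto simp: w_def chains_def)
  then have "0 = augmentation F (boundary_map F 0 w)" using augmentation_boundary_map by simp
  also have "\<dots> = (\<Sum>c<rk F 0. aug F c * lookup (z c) m)"
    unfolding augmentation_def
  proof (rule sum.cong)
    fix c assume c: "c \<in> {..<rk F 0}"
    have "lookup (boundary_map F 0 w c) 0 = lookup (z c) m"
      using c y(1)
      by (simp add: y(2) boundary_map_def lookup_sum lookup_zero_times w_def coeff chains_def)
    then show "aug F c * lookup (boundary_map F 0 w c) 0 = aug F c * lookup (z c) m" by simp
  qed simp
  also have "\<dots> = (\<Sum>c<rk F 0. if c = c0 then aug F c0 else 0)"
    by (rule sum.cong) (auto simp: z_def lookup_mon)
  also have "\<dots> = aug F c0" using c0 by simp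
  finally show False using c0 by simp
qed

text \<open>
  The connecting map \<open>Tor\<^sub>1(K, I + J) \<rightarrow> Tor\<^sub>0(K, I \<inter> J)\<close> hits the generator \<open>u\<close> of a principal
  intersection when \<open>u\<close> becomes zero in \<open>Tor\<^sub>0(K, I)\<close> and \<open>Tor\<^sub>0(K, J)\<close>, that is, when it is not
  a minimal generator of either ideal.
\<close>

lemma not_tor_vanishes_union:
  assumes u: "monomial_ideal A \<inter> monomial_ideal B = (monomial_ideal {u} :: ('n, 'k) mpoly set)"
    and a: "a \<in> A" "a \<preceq> u" "a \<noteq> u" and b: "b \<in> B" "b \<preceq> u" "b \<noteq> u"
  shows "\<not> tor_vanishes (monomial_ideal (A \<union> B)) 1 (int (total_degree u))"
proof
  assume *: "tor_vanishes (monomial_ideal (A \<union> B)) 1 (int (total_degree u))"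
  obtain c0 where c0: "c0 < rk F 0" "aug F c0 \<noteq> 0" by (rule augmentation_unit)
  define e where "e f = (\<lambda>c. if c = c0 then f else (0 :: ('n, 'k) mpoly))" for f
  have lift: "\<exists>y. y \<in> chains F (monomial_ideal A) (Suc 0)
      \<and> y \<in> chains_deg F (Suc 0) (int (total_degree u)) \<and>
      boundary_map F 0 y = e (mon u)" if a: "a \<in> A" "a \<preceq> u" "a \<noteq> u" for a A
  proof -
    have "u - a \<noteq> 0" using a divides_add_minus by fastforce
    then have "augmentation F (e (mon (u - a))) = 0"
      by (auto simp: augmentation_def e_def lookup_mon intro!: sum.neutral)
    then have "e (mon (u - a)) \<in> boundaries F UNIV 0"
      unfolding exact_augmentation[symmetric] using c0 by (auto simp: e_def chains_def)
    moreover have "e (mon (u - a)) \<in> chains_deg F 0 (int (total_degree (u - a)))"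
      using c0 by (auto simp: e_def chains_deg_def homogeneous_mon shift_aug)
    ultimately obtain w where w: "w \<in> chains F UNIV (Suc 0)"
      "w \<in> chains_deg F (Suc 0) (int (total_degree (u - a)))" "e (mon (u - a)) = boundary_map F 0 w"
      using homogeneous_boundary[of _ "{0}" 0] unfolding monomial_ideal_zero_exponent by metis
    define y where "y = (\<lambda>c. mon a * w c)"
    have deg: "total_degree u = total_degree a + total_degree (u - a)"
      using total_degree_add[of a "u - a"] a by (simp add: divides_add_minus)
    have mon_u: "mon a * mon (u - a) = (mon u :: ('n, 'k) mpoly)"
      using a by (simp add: divides_add_minus flip: mon_add)
    have "y \<in> chains F (monomial_ideal A) (Suc 0)"
      using w(1) monomial_ideal_times[OF mon_in_monomial_ideal[OF a(1)]]
      by (auto simp: y_def chains_def mult.commute[of "mon a"])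
    moreover have "y \<in> chains_deg F (Suc 0) (int (total_degree u))"
      using w(2) deg by (auto simp: y_def chains_deg_def homogeneous_mon_times algebra_simps)
    moreover have "boundary_map F 0 y = e (mon u)"
      by (auto simp: y_def boundary_map_scale w(3)[symmetric] e_def mon_u fun_eq_iff)
    ultimately show ?thesis by blast
  qed
  obtain x where x: "x \<in> chains F (monomial_ideal A) (Suc 0)"
      "x \<in> chains_deg F (Suc 0) (int (total_degree u))"
    "boundary_map F 0 x = e (mon u)" using lift[OF a] by blast
  obtain y where y: "y \<in> chains F (monomial_ideal B) (Suc 0)"
      "y \<in> chains_deg F (Suc 0) (int (total_degree u))"
    "boundary_map F 0 y = e (mon u)" using lift[OF b] by blast
  have "x - y \<in> cycles F (monomial_ideal (A \<union> B)) 1"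
    using x y by (auto simp: cycles_def boundary_map_diff
        intro!: chains_diff intro: chains_mono[OF monomial_ideal_mono, rotated])
  then have "x - y \<in> boundaries F (monomial_ideal (A \<union> B)) 1"
    using * x(2) y(2) chains_deg_diff unfolding tor_vanishes_def by auto
  then obtain t where t: "t \<in> chains F (monomial_ideal (A \<union> B)) (Suc (Suc 0))"
    "x - y = boundary_map F (Suc 0) t"
    by (auto simp: boundaries_def)
  obtain p q where pq: "p \<in> chains F (monomial_ideal A) (Suc (Suc 0))"
    "q \<in> chains F (monomial_ideal B) (Suc (Suc 0))" "t = p + q"
    using split_chain[OF t(1)] by metis
  \<comment> \<open>The common value \<open>s\<close> of two lifts would have coefficients in the intersection.\<close>
  define s where "s = x - boundary_map F (Suc 0) p"
  have s': "s = y + boundary_map F (Suc 0) q"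
    using t(2) pq(3) by (simp add: s_def boundary_map_add algebra_simps)
  have "s \<in> chains F (monomial_ideal A) (Suc 0)"
    unfolding s_def using x pq by (intro chains_diff boundary_map_chains)
  moreover have "s \<in> chains F (monomial_ideal B) (Suc 0)"
    unfolding s' using y pq by (intro chains_add boundary_map_chains)
  ultimately have "s \<in> chains F (monomial_ideal ((+) u ` {0})) (Suc 0)"
    using u by (auto simp: chains_def)
  then obtain r where r: "r \<in> chains F (monomial_ideal {0}) (Suc 0)" "s = (\<lambda>c. mon u * r c)"
    by (rule chains_translate)
  have "boundary_map F 0 s = e (mon u)"
    using x(3) boundary_map_boundary_map[OF pq(1)] by (simp add: s_def boundary_map_diff)
  then have "mon u * boundary_map F 0 r c = mon u * e 1 c" for c
    using boundary_map_scale[of 0 "mon u" r] r(2) by (auto simp: fun_eq_iff e_def)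
  then have "boundary_map F 0 r = e 1" unfolding mon_times_cancel by blast
  then have "augmentation F (e 1) = 0"
    using augmentation_boundary_map[OF r(1)] by simp
  moreover have "augmentation F (e 1) = (\<Sum>c<rk F 0. if c = c0 then aug F c0 else 0)"
    unfolding augmentation_def by (rule sum.cong) (auto simp: e_def)
  ultimately show False using c0 by simp
qed

end

subsection \<open>Dimensions and the regularity\<close>

text \<open>The dimension of an infinite-dimensional space is \<open>0\<close> by convention, whence the finite
  spanning set.\<close>

lemma (in vector_space) dim_strict_mono:
  assumes "subspace S" "S \<subseteq> T" "x \<in> T" "x \<notin> S" "T \<subseteq> span B" "finite B"
  shows "dim S < dim T"
proof -
  obtain C where C: "C \<subseteq> S" "independent C" "S \<subseteq> span C" "card C = dim S"
    using basis_exists[of S] by blast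
  have "span C \<subseteq> S" using C(1) assms(1) by (rule span_minimal)
  then have "x \<notin> span C" using assms(4) by blast
  then have "independent (insert x C)" using C(2) by (simp add: independent_insert)
  moreover have "insert x C \<subseteq> T" using C(1) assms by blast
  ultimately obtain D where D: "insert x C \<subseteq> D" "D \<subseteq> T" "independent D" "T \<subseteq> span D"
    using maximal_independent_subset_extend by metis
  have "finite D" using independent_span_bound[OF assms(6) D(3)] D(2) assms(5) by blast
  then have "card (insert x C) \<le> card D" "finite C" using D(1)
    by (auto intro: card_mono finite_subset)
  moreover have "card D = dim T" using D by (simp add: basis_card_eq_dim)
  moreover have "x \<notin> C" using \<open>x \<notin> span C\<close> span_base by blast
  ultimately show ?thesis using C(4) by simp
qed

lemma sum_fun_apply: "(\<Sum>x\<in>S. f x) y = (\<Sum>x\<in>S. f x y)"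
  by (induction S rule: infinite_finite_induct) auto

context field_resolution
begin

lemma chains_deg_finite_span:
  "\<exists>B. finite B \<and> chains F I p \<inter> chains_deg F p j \<subseteq> module.span kscale B"
proof -
  interpret K: vector_space "kscale :: 'k \<Rightarrow> (nat \<Rightarrow> ('n, 'k) mpoly) \<Rightarrow> _"
    by (rule vector_space_kscale)
  define e :: "nat \<times> ('n \<Rightarrow>\<^sub>0 nat) \<Rightarrow> nat \<Rightarrow> ('n, 'k) mpoly"
    where "e = (\<lambda>(c, m) d. if d = c then mon m else 0)"
  define M where "M = (\<lambda>c. {m :: 'n \<Rightarrow>\<^sub>0 nat. total_degree m = nat (j - shift F p c)})"
  have fin: "finite (M c)" for c by (simp add: M_def finite_total_degree)
  have "v \<in> K.span (e ` Sigma {..<rk F p} M)"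
    if v: "v \<in> chains F I p" "v \<in> chains_deg F p j" for v
  proof -
    have keys: "keys (v c) \<subseteq> M c" if "c < rk F p" for c
      using v(2) that by (fastforce simp: chains_deg_def homogeneous_iff M_def)
    have "v = (\<Sum>c<rk F p. \<Sum>m\<in>M c. kscale (lookup (v c) m) (e (c, m)))"
    proof
      fix d
      have "(\<Sum>c<rk F p. \<Sum>m\<in>M c. kscale (lookup (v c) m) (e (c, m))) d
          = (\<Sum>c<rk F p. if c = d then (\<Sum>m\<in>M d. single m (lookup (v d) m)) else 0)"
        unfolding sum_fun_apply
        by (rule sum.cong) (auto simp: kscale_def e_def mon_def mult_single)
      also have "\<dots> = v d"
      proof (cases "d < rk F p")
        case True
        then show ?thesis using mpoly_sum_single[OF fin keys[OF True]] by (simp add: sum.delta)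
      next
        case False
        then show ?thesis using v(1) by (simp add: chains_def)
      qed
      finally show "v d = (\<Sum>c<rk F p. \<Sum>m\<in>M c. kscale (lookup (v c) m) (e (c, m))) d" by simp
    qed
    also have "\<dots> \<in> K.span (e ` Sigma {..<rk F p} M)"
      by (intro K.span_sum K.span_scale K.span_base) auto
    finally show ?thesis .
  qed
  then show ?thesis using fin by (intro exI[of _ "e ` Sigma {..<rk F p} M"]) auto
qed

lemma subspace_boundaries:
  "module.subspace kscale (boundaries F (monomial_ideal A) p \<inter> chains_deg F p j)"
proof -
  interpret K: vector_space "kscale :: 'k \<Rightarrow> (nat \<Rightarrow> ('n, 'k) mpoly) \<Rightarrow> _"
    by (rule vector_space_kscale)
  show ?thesis
  proof (rule K.subspaceI)
    show "0 \<in> boundaries F (monomial_ideal A) p \<inter> chains_deg F p j"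
    proof -
      have "0 = boundary_map F p 0" "0 \<in> chains F (monomial_ideal A) (Suc p)"
        by (auto simp: boundary_map_def chains_def fun_eq_iff)
      then show ?thesis by (auto simp: boundaries_def chains_deg_def)
    qed
  next
    fix v w assume "v \<in> boundaries F (monomial_ideal A) p \<inter> chains_deg F p j"
      "w \<in> boundaries F (monomial_ideal A) p \<inter> chains_deg F p j"
    then show "v + w \<in> boundaries F (monomial_ideal A) p \<inter> chains_deg F p j"
      by (auto simp: boundaries_def chains_deg_add boundary_map_add[symmetric]
          intro!: imageI chains_add)
  next
    fix a v assume v: "v \<in> boundaries F (monomial_ideal A) p \<inter> chains_deg F p j"
    then obtain x where x: "x \<in> chains F (monomial_ideal A) (Suc p)" "v = boundary_map F p x"
      by (auto simp: boundaries_def)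
    have "kscale a v = boundary_map F p (kscale a x)"
        "kscale a x \<in> chains F (monomial_ideal A) (Suc p)"
      using x by (auto simp: kscale_def boundary_map_scale chains_def monomial_ideal_times)
    moreover have "kscale a v \<in> chains_deg F p j"
    proof -
      have "homogeneous 0 (single 0 a :: ('n, 'k) mpoly)" by (simp add: homogeneous_iff)
      then show ?thesis
        using v homogeneous_mult[of 0 "single 0 a"] by (fastforce simp: chains_deg_def kscale_def)
    qed
    ultimately show "kscale a v \<in> boundaries F (monomial_ideal A) p \<inter> chains_deg F p j"
      by (auto simp: boundaries_def)
  qed
qed

text \<open>As the spaces of chains of a fixed degree are finite-dimensional, the difference of the
  dimensions of cycles and boundaries is zero exactly when the homology is.\<close>

lemma homology_dim_iff:
  "vector_space.dim kscale (cycles F (monomial_ideal A) i \<inter> chains_deg F i j)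
    - vector_space.dim kscale (boundaries F (monomial_ideal A) i \<inter> chains_deg F i j) \<noteq> 0
    \<longleftrightarrow> \<not> tor_vanishes (monomial_ideal A) i j"
proof -
  interpret K: vector_space "kscale :: 'k \<Rightarrow> (nat \<Rightarrow> ('n, 'k) mpoly) \<Rightarrow> _"
    by (rule vector_space_kscale)
  let ?Z = "cycles F (monomial_ideal A) i \<inter> chains_deg F i j"
  let ?B = "boundaries F (monomial_ideal A) i \<inter> chains_deg F i j"
  have sub: "?B \<subseteq> ?Z" using boundaries_subset_cycles by blast
  show ?thesis
  proof (cases "tor_vanishes (monomial_ideal A) i j")
    case True
    then have "?Z = ?B" using sub by (auto simp: tor_vanishes_def)
    then show ?thesis using True by simp
  next
    case False
    then obtain x where x: "x \<in> ?Z" "x \<notin> ?B" by (auto simp: tor_vanishes_def)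
    obtain S where S: "finite S" "chains F (monomial_ideal A) i \<inter> chains_deg F i j \<subseteq> K.span S"
      using chains_deg_finite_span by blast
    then have "?Z \<subseteq> K.span S" by (auto simp: cycles_def)
    then have "K.dim ?B < K.dim ?Z"
      using K.dim_strict_mono[OF subspace_boundaries sub x _ S(1)] by blast
    then show ?thesis using False by simp
  qed
qed

end

section \<open>A free resolution of the field\<close>

text \<open>
  The resolution has the words in the variables as its basis, those of length \<open>p\<close> in position
  \<open>p\<close>; a word has the multidegree of the squarefree monomial on its letters. In multidegree \<open>a\<close> it
  is the complex of ordered simplices of the full simplex on the support of \<open>a\<close>, where
  prepending a letter from the support is a contracting homotopy. Compared with the Koszul complex
  this avoids sign conventions for subsets.
  On coefficients, \<open>word_boundary C w\<close> is the alternating sum of \<open>C\<close> over all ways to insert a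
  letter into \<open>w\<close>.
\<close>

fun word_boundary :: "('n::finite list \<Rightarrow> 'k::field) \<Rightarrow> 'n list \<Rightarrow> 'k" where
  "word_boundary C [] = (\<Sum>x\<in>UNIV. C [x])"
| "word_boundary C (y # w) = (\<Sum>x\<in>UNIV. C (x # y # w)) - word_boundary (\<lambda>u. C (y # u)) w"

lemma word_boundary_cong:
  assumes "\<And>u. length u = Suc (length w) \<Longrightarrow> set w \<subseteq> set u \<Longrightarrow> C u = D u"
  shows "word_boundary C w = word_boundary D w"
  using assms
proof (induction w arbitrary: C D)
  case (Cons y w)
  have "word_boundary (\<lambda>u. C (y # u)) w = word_boundary (\<lambda>u. D (y # u)) w"
    by (rule Cons.IH) (auto intro!: Cons.prems)
  moreover have "(\<Sum>x\<in>UNIV. C (x # y # w)) = (\<Sum>x\<in>UNIV. D (x # y # w))"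
    by (rule sum.cong) (auto intro!: Cons.prems)
  ultimately show ?case by simp
qed auto

lemma word_boundary_zero: "word_boundary (\<lambda>_. 0) w = 0"
  by (induction w) auto

lemma word_boundary_sum:
  "word_boundary (\<lambda>u. \<Sum>s\<in>S. f s u) w = (\<Sum>s\<in>S. word_boundary (f s) w)"
proof (induction w arbitrary: f)
  case Nil
  show ?case by (simp add: sum.swap[of _ _ S])
next
  case (Cons y w)
  show ?case by (simp add: Cons sum_subtractf sum.swap[of _ _ S])
qed

lemma word_boundary_times: "word_boundary (\<lambda>u. c * C u) w = c * word_boundary C w"
  by (induction w arbitrary: C) (simp_all add: sum_distrib_left right_diff_distrib)

lemma word_boundary_diff:
  "word_boundary (\<lambda>u. C u - D u) w = word_boundary C w - word_boundary D w"
  by (induction w arbitrary: C D) (simp_all add: sum_subtractf)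

lemma word_boundary_word_boundary: "word_boundary (word_boundary C) w = 0"
proof (induction w arbitrary: C)
  case Nil
  show ?case by (simp add: sum_subtractf sum.swap[of "\<lambda>x y. C [x, y]"])
next
  case (Cons y w)
  have "(\<Sum>x\<in>UNIV. \<Sum>z\<in>UNIV. C (z # x # y # w)) = (\<Sum>x\<in>UNIV. \<Sum>z\<in>UNIV. C (x # z # y # w))"
    by (rule sum.swap)
  then show ?case
    by (simp add: sum_subtractf word_boundary_diff word_boundary_sum Cons)
qed

definition words :: "nat \<Rightarrow> 'n list set" where
  "words p = {w. length w = p}"

lemma finite_words: "finite (words p :: 'n::finite list set)"
  using finite_lists_length_eq[of "UNIV :: 'n set" p] by (simp add: words_def)

definition word_at :: "nat \<Rightarrow> nat \<Rightarrow> 'n::finite list" where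
  "word_at p = (SOME f. bij_betw f {..<card (words p :: 'n list set)} (words p))"

lemma bij_word_at: "bij_betw (word_at p) {..<card (words p :: 'n list set)}
    (words p :: 'n::finite list set)"
  unfolding word_at_def
  using someI_ex[OF ex_bij_betw_nat_finite[OF finite_words[of p, where 'n='n]]]
  by (simp add: atLeast0LessThan)

definition word_index :: "'n::finite list \<Rightarrow> nat" where
  "word_index w = inv_into {..<card (words (length w) :: 'n list set)} (word_at (length w)) w"

lemma length_word_at: "c < card (words p :: 'n list set) \<Longrightarrow> length (word_at p c :: 'n::finite list)
    = p"
  using bij_betwE[OF bij_word_at[of p, where 'n='n]] by (auto simp: words_def)

lemma word_index_word_at:
  "c < card (words p :: 'n list set) \<Longrightarrow> word_index (word_at p c :: 'n::finite list) = c"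
  by (simp add: word_index_def length_word_at bij_word_at[THEN bij_betw_inv_into_left])

lemma
  assumes "length w = p"
  shows word_index_less: "word_index (w :: 'n::finite list) < card (words p :: 'n list set)"
    and word_at_word_index: "word_at p (word_index w) = w"
proof -
  have w: "w \<in> words p" using assms by (simp add: words_def)
  then show "word_at p (word_index w) = w"
    using bij_word_at[THEN bij_betw_inv_into_right] assms by (simp add: word_index_def)
  show "word_index w < card (words p :: 'n list set)"
    using bij_betw_apply[OF bij_betw_inv_into[OF bij_word_at] w] assms by (simp add: word_index_def)
qed

text \<open>The entry of the boundary matrix in row \<open>w\<close> and column \<open>u\<close>, up to a monomial factor.\<close>

definition word_coeff :: "'n::finite list \<Rightarrow> 'n list \<Rightarrow> 'k::field" where
  "word_coeff u = word_boundary (\<lambda>w. if w = u then 1 else 0)"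

lemma word_coeff_nonzero:
  assumes "(word_coeff u w :: 'k::field) \<noteq> 0"
  shows "set w \<subseteq> set u"
proof (rule ccontr)
  assume "\<not> set w \<subseteq> set u"
  then have "(word_coeff u w :: 'k) = word_boundary (\<lambda>_. 0) w"
    unfolding word_coeff_def by (intro word_boundary_cong) auto
  with assms show False by (simp add: word_boundary_zero)
qed

lemma word_boundary_expand:
  fixes w :: "'n::finite list"
  assumes "length w = p"
  shows "word_boundary C w = (\<Sum>u\<in>words (Suc p). word_coeff u w * C u)"
proof -
  have "word_boundary C w =
      word_boundary (\<lambda>v. \<Sum>u\<in>words (Suc p). C u * (if v = u then 1 else 0)) w"
    using assms finite_words[of "Suc p", where 'n='n]
    by (intro word_boundary_cong) (simp add: words_def if_distrib[of
        "times _"] sum.delta cong: if_cong)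
  then show ?thesis
    by (simp add: word_boundary_sum word_boundary_times word_coeff_def mult.commute)
qed

text \<open>The difference of exponents in the matrix is not truncated where it matters, because an entry
  can be nonzero only if the letters of the row occur in the column.\<close>

definition word_complex :: "('n::finite, 'k::field) free_complex" where
  "word_complex =
    \<lparr>rk = (\<lambda>p. card (words p :: 'n list set)),
     shift = (\<lambda>p c. int (card (set (word_at p c :: 'n list)))),
     mat = (\<lambda>p r c. single (chi (set (word_at (Suc p) c)) - chi (set (word_at p r)))
       (word_coeff (word_at (Suc p) c :: 'n list) (word_at p r))),
     aug = (\<lambda>_. 1)\<rparr>"

lemma rk_word_complex: "rk (word_complex :: ('n::finite, 'k::field) free_complex) p
    = card (words p :: 'n list set)"
  by (simp add: word_complex_def)

text \<open>The coefficient of the word \<open>w\<close> in the component of multidegree \<open>a\<close> of a chain.\<close>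

definition word_component ::
    "nat \<Rightarrow> (nat \<Rightarrow> ('n::finite, 'k::field) mpoly) \<Rightarrow> ('n \<Rightarrow>\<^sub>0 nat) \<Rightarrow> 'n list \<Rightarrow> 'k" where
  "word_component p v a w =
     (if length w = p \<and> chi (set w) \<preceq> a then lookup (v (word_index w)) (a - chi (set w)) else 0)"

lemma word_component_zero: "word_component p 0 a w = 0"
  by (simp add: word_component_def)

text \<open>In each multidegree the boundary map of the resolution is the combinatorial one.\<close>

lemma word_component_boundary_map:
  fixes v :: "nat \<Rightarrow> ('n::finite, 'k::field) mpoly"
  assumes w: "length w = p"
  shows "word_component p (boundary_map word_complex p v) a w
    = word_boundary (word_component (Suc p) v a) w"
proof (cases "chi (set w) \<preceq> a")
  case False
  have "\<not> chi (set u) \<preceq> a" if "set w \<subseteq> set u" for u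
    using that False unfolding chi_divides_iff by blast
  then have "word_boundary (word_component (Suc p) v a) w = word_boundary (\<lambda>_. 0) w"
    by (intro word_boundary_cong) (simp add: word_component_def)
  then show ?thesis using False by (simp add: word_component_def word_boundary_zero)
next
  case True
  let ?m = "a - chi (set w)"
  have "word_component p (boundary_map word_complex p v) a w
    = (\<Sum>c<card (words (Suc p) :: 'n list set).
        lookup (single (chi (set (word_at (Suc p) c)) - chi (set w))
          (word_coeff (word_at (Suc p) c) w) * v c) ?m)"
    using True w word_index_less[OF w] word_at_word_index[OF w]
    by (simp add: word_component_def boundary_map_def rk_word_complex lookup_sum)
       (simp add: word_complex_def)
  also have "\<dots> = (\<Sum>c<card (words (Suc p) :: 'n list set).
      word_coeff (word_at (Suc p) c) w * word_component (Suc p) v a (word_at (Suc p) c))"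
  proof (rule sum.cong)
    fix c assume "c \<in> {..<card (words (Suc p) :: 'n list set)}"
    then have c: "c < card (words (Suc p) :: 'n list set)" by simp
    let ?u = "word_at (Suc p) c"
    show "lookup (single (chi (set ?u) - chi (set w)) (word_coeff ?u w) * v c) ?m
        = word_coeff ?u w * word_component (Suc p) v a ?u"
    proof (cases "(word_coeff ?u w :: 'k) = 0")
      case False
      have sub: "set w \<subseteq> set ?u" using word_coeff_nonzero[OF False] .
      have "chi (set ?u) - chi (set w) \<preceq> ?m \<longleftrightarrow> chi (set ?u) \<preceq> a"
      proof -
        have "lookup (chi (set ?u) - chi (set w)) i \<le> lookup ?m i
            \<longleftrightarrow> lookup (chi (set ?u)) i \<le> lookup a i" for i
          using True sub by (auto simp: lookup_minus lookup_chi chi_divides_iff Suc_le_eq)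
        then show ?thesis by (simp add: divides_def)
      qed
      moreover have "?m - (chi (set ?u) - chi (set w)) = a - chi (set ?u)"
        using sub True
        by (intro poly_mapping_eqI) (auto simp: lookup_minus lookup_chi chi_divides_iff)
      ultimately show ?thesis
        by (simp add: lookup_single_times word_component_def length_word_at[OF c]
            word_index_word_at[OF c])
    qed simp
  qed simp
  also have "\<dots> = (\<Sum>u\<in>words (Suc p). word_coeff u w * word_component (Suc p) v a u)"
    by (rule sum.reindex_bij_betw[OF bij_word_at])
  also have "\<dots> = word_boundary (word_component (Suc p) v a) w"
    by (simp add: word_boundary_expand[OF w])
  finally show ?thesis .
qed

lemma chain_eqI:
  fixes v v' :: "nat \<Rightarrow> ('n::finite, 'k::field) mpoly"
  assumes "v \<in> chains word_complex UNIV p" "v' \<in> chains word_complex UNIV p"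
    and eq: "\<And>a w. length w = p \<Longrightarrow> word_component p v a w = word_component p v' a w"
  shows "v = v'"
proof
  fix c
  show "v c = v' c"
  proof (cases "c < card (words p :: 'n list set)")
    case True
    let ?w = "word_at p c :: 'n list"
    have "lookup (v c) m = lookup (v' c) m" for m
      using eq[of ?w "chi (set ?w) + m"] True
      by (simp add: word_component_def length_word_at word_index_word_at)
    then show ?thesis by (rule poly_mapping_eqI)
  next
    case False
    then show ?thesis using assms(1,2) by (simp add: chains_def rk_word_complex)
  qed
qed

lemma boundary_map_in_chains: "boundary_map F p v \<in> chains F UNIV p"
  by (simp add: chains_def boundary_map_def)

text \<open>Exactness: the chain \<open>v\<close> is the boundary of the chain whose components are obtained from
  those of \<open>v\<close> by prepending a letter of the support of the multidegree.\<close>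

lemma word_complex_exact:
  fixes v :: "nat \<Rightarrow> ('n::finite, 'k::field) mpoly"
  assumes v: "v \<in> chains word_complex UNIV p"
    and cycle: "\<And>a u. Suc (length u) = p \<Longrightarrow> word_boundary (word_component p v a) u = 0"
    and aug: "word_component p v 0 [] = 0"
  shows "v \<in> boundaries word_complex UNIV p"
proof -
  define i where "i a = (SOME i. lookup a i \<noteq> 0)" for a :: "'n \<Rightarrow>\<^sub>0 nat"
  have i: "lookup a (i a) \<noteq> 0" if "a \<noteq> 0" for a
    unfolding i_def using that by (rule_tac someI_ex) (metis lookup_zero poly_mapping_eqI)
  define h where "h a w = (case w of [] \<Rightarrow> 0
    | x # u \<Rightarrow> if a \<noteq> 0 \<and> x = i a then word_component p v a u else 0)" for a w
  define v' where "v' c = (if c < card (words (Suc p) :: 'n list set)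
    then Abs_poly_mapping (\<lambda>m. h (m + chi (set (word_at (Suc p) c))) (word_at (Suc p) c)) else 0)"
        for c
  have fin: "finite {m. h (m + chi (set w)) w \<noteq> 0}" for w
  proof (cases w)
    case (Cons x u)
    let ?K = "(+) (chi (set u)) ` keys (v (word_index u))"
    have "m + chi (set w) \<in> ?K" if "h (m + chi (set w)) w \<noteq> 0" for m
    proof -
      let ?a = "m + chi (set w)"
      have "chi (set u) \<preceq> ?a" "?a - chi (set u) \<in> keys (v (word_index u))"
        using that Cons by (auto simp: h_def word_component_def in_keys_iff split: if_splits)
      then show ?thesis by (metis divides_add_minus imageI)
    qed
    then have "{m. h (m + chi (set w)) w \<noteq> 0} \<subseteq> (\<lambda>m. m + chi (set w)) -` ?K" by blast
    moreover have "finite ((\<lambda>m. m + chi (set w)) -` ?K)"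
      by (rule finite_vimageI) auto
    ultimately show ?thesis by (rule finite_subset)
  qed (simp add: h_def)
  have comp: "word_component (Suc p) v' a w = h a w" if w: "length w = Suc p" for a w
  proof (cases "chi (set w) \<preceq> a")
    case True
    have "a - chi (set w) + chi (set w) = a"
      using divides_add_minus[OF True] by (simp add: add.commute)
    then show ?thesis
      using True w by (simp add: word_component_def v'_def word_index_less word_at_word_index fin)
  next
    case False
    have "h a w = 0"
    proof (rule ccontr)
      assume "h a w \<noteq> 0"
      then obtain u where "w = i a # u" "a \<noteq> 0" "chi (set u) \<preceq> a"
        by (auto simp: h_def word_component_def split: list.splits if_splits)
      then have "chi (set w) \<preceq> a" using i by (auto simp: chi_divides_iff)
      with False show False by simp
    qed
    then show ?thesis using False by (simp add: word_component_def)
  qed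
  have "word_component p (boundary_map word_complex p v') a w = word_component p v a w"
    if w: "length w = p" for a w
  proof -
    have "word_component p (boundary_map word_complex p v') a w = word_boundary (h a) w"
      unfolding word_component_boundary_map[OF w] using w
      by (intro word_boundary_cong) (simp add: comp)
    also have "\<dots> = word_component p v a w"
    proof (cases "a = 0")
      case True
      have "h a = (\<lambda>_. 0)" using True by (auto simp: h_def fun_eq_iff split: list.splits)
      moreover have "word_component p v a w = 0"
      proof (cases w)
        case (Cons x u)
        then show ?thesis using True by (auto simp: word_component_def chi_divides_iff)
      qed (use aug True in simp)
      ultimately show ?thesis by (simp add: word_boundary_zero)
    next
      case False
      show ?thesis
      proof (cases w)
        case Nil
        then show ?thesis using False by (simp add: h_def sum.delta)
      next
        case (Cons y u)
        have "word_boundary (\<lambda>u. h a (y # u)) u = 0"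
        proof (cases "y = i a")
          case True
          then show ?thesis using False cycle[of u a] w Cons by (simp add: h_def)
        next
          case ne: False
          then show ?thesis by (simp add: h_def word_boundary_zero)
        qed
        then show ?thesis using False Cons by (simp add: h_def sum.delta)
      qed
    qed
    finally show ?thesis .
  qed
  then have "boundary_map word_complex p v' = v"
    by (intro chain_eqI[OF boundary_map_in_chains v])
  moreover have "v' \<in> chains word_complex UNIV (Suc p)"
    by (simp add: chains_def rk_word_complex v'_def)
  ultimately show ?thesis unfolding boundaries_def by blast
qed

lemma word_complex_resolution:
  "graded_free_resolution_of_field (word_complex :: ('n::finite, 'k::field) free_complex)"
  unfolding graded_free_resolution_of_field_def
proof (intro conjI allI impI)
  let ?F = "word_complex :: ('n, 'k) free_complex"
  have words0: "words 0 = {[] :: 'n list}" by (auto simp: words_def)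
  have rk0: "rk ?F 0 = 1" by (simp add: rk_word_complex words0)
  have index0: "word_index ([] :: 'n list) = 0"
    using word_index_less[of "[] :: 'n list" 0] by (simp add: words0)
  have augmentation: "augmentation ?F v = word_component 0 v 0 []" for v
    by (simp add: augmentation_def rk0 word_component_def index0 chi_empty)
       (simp add: word_complex_def)
  show "homogeneous (shift ?F (Suc p) c - shift ?F p r) (mat ?F p r c)"
    if "r < rk ?F p" "c < rk ?F (Suc p)" for p r c
  proof (cases "(word_coeff (word_at (Suc p) c :: 'n list) (word_at p r) :: 'k) = 0")
    case True
    then show ?thesis by (simp add: word_complex_def)
  next
    case False
    let ?u = "word_at (Suc p) c :: 'n list" and ?w = "word_at p r :: 'n list"
    have "set ?w \<subseteq> set ?u" by (rule word_coeff_nonzero[OF False])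
    then have "chi (set ?w) \<preceq> chi (set ?u)" by (auto simp: chi_divides_iff lookup_chi)
    then have "total_degree (chi (set ?u))
        = total_degree (chi (set ?w)) + total_degree (chi (set ?u) - chi (set ?w))"
      by (simp add: divides_add_minus flip: total_degree_add)
    then show ?thesis by (simp add: word_complex_def homogeneous_iff total_degree_chi)
  qed
  show "shift ?F 0 c = 0" if "c < rk ?F 0" "aug ?F c \<noteq> 0" for c
    using that length_word_at[of c 0, where 'n='n]
      by (simp add: rk_word_complex) (simp add: word_complex_def)
  show "augmentation ?F ` chains ?F UNIV 0 = UNIV"
  proof -
    have "a \<in> augmentation ?F ` chains ?F UNIV 0" for a
    proof -
      define v where "v = (\<lambda>c :: nat. if c = 0 then single 0 a else (0 :: ('n, 'k) mpoly))"
      have "v \<in> chains ?F UNIV 0" by (auto simp: v_def chains_def rk0)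
      moreover have "augmentation ?F v = a"
        by (simp add: augmentation word_component_def index0 chi_empty v_def)
      ultimately show ?thesis by blast
    qed
    then show ?thesis by blast
  qed
  show "{v \<in> chains ?F UNIV 0. augmentation ?F v = 0} = boundaries ?F UNIV 0"
  proof (intro equalityI subsetI)
    fix v assume "v \<in> {v \<in> chains ?F UNIV 0. augmentation ?F v = 0}"
    then show "v \<in> boundaries ?F UNIV 0" by (intro word_complex_exact) (auto simp: augmentation)
  next
    fix v assume "v \<in> boundaries ?F UNIV 0"
    then obtain y where "v = boundary_map ?F 0 y" by (auto simp: boundaries_def)
    moreover have "augmentation ?F (boundary_map ?F 0 y) = 0"
      by (simp add: augmentation word_component_boundary_map)
        (simp add: word_component_def chi_divides_iff)
    ultimately show "v \<in> {v \<in> chains ?F UNIV 0. augmentation ?F v = 0}"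
      by (simp add: boundary_map_in_chains)
  qed
  show "cycles ?F UNIV (Suc p) = boundaries ?F UNIV (Suc p)" for p
  proof (intro equalityI subsetI)
    fix v assume v: "v \<in> cycles ?F UNIV (Suc p)"
    have "word_boundary (word_component (Suc p) v a) u = 0" if "length u = p" for a u
      using word_component_boundary_map[OF that, of v a] v
      by (simp add: cycles_def word_component_zero)
    then show "v \<in> boundaries ?F UNIV (Suc p)"
      using v by (intro word_complex_exact) (auto simp: cycles_def word_component_def)
  next
    fix v assume "v \<in> boundaries ?F UNIV (Suc p)"
    then obtain y where y: "v = boundary_map ?F (Suc p) y" by (auto simp: boundaries_def)
    have "boundary_map ?F p v = 0"
    proof (rule chain_eqI[OF boundary_map_in_chains])
      fix a and w :: "'n list" assume w: "length w = p"
      have "word_component p (boundary_map ?F p v) a w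
          = word_boundary (word_boundary (word_component (Suc (Suc p)) y a)) w"
        unfolding word_component_boundary_map[OF w] y using w
        by (intro word_boundary_cong) (simp add: word_component_boundary_map)
      then show "word_component p (boundary_map ?F p v) a w = word_component p 0 a w"
        by (simp add: word_boundary_word_boundary word_component_zero)
    qed (simp add: chains_def)
    then show "v \<in> cycles ?F UNIV (Suc p)"
      using boundary_map_in_chains[of ?F "Suc p" y] by (simp add: cycles_def y)
  qed
qed

section \<open>Vertex splittings\<close>

text \<open>
  A vertex splitting of an ideal that is generated in the single degree \<open>d\<close>, recorded on the
  exponents of the generators. The equality of all degrees makes every set that occurs an antichain
  under divisibility, so these exponents are the minimal ones.
\<close>

inductive vertex_splitting :: "'n::finite set \<Rightarrow> nat \<Rightarrow> ('n \<Rightarrow>\<^sub>0 nat) set \<Rightarrow> bool" where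
  empty: "vertex_splitting V d {}"
| singleton: "keys m \<subseteq> V \<Longrightarrow> vertex_splitting V (total_degree m) {m}"
| split: "v \<in> V \<Longrightarrow> vertex_splitting V d A \<Longrightarrow> vertex_splitting (V - {v}) (Suc d) B \<Longrightarrow>
    (\<And>b. b \<in> B \<Longrightarrow> \<exists>a\<in>A. a \<preceq> b) \<Longrightarrow> vertex_splitting V (Suc d) ((+) (single v 1) ` A \<union> B)"

lemma total_degree_single: "total_degree (single v n) = n"
  by (simp add: total_degree_def lookup_single when_def)

lemma keys_add_nat: "keys (a + b :: 'n \<Rightarrow>\<^sub>0 nat) = keys a \<union> keys b"
  by (auto simp: in_keys_iff lookup_add)

lemma vertex_splitting_degree: "vertex_splitting V d A \<Longrightarrow> a \<in> A \<Longrightarrow> total_degree a = d"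
  by (induction arbitrary: a rule: vertex_splitting.induct)
      (auto simp: total_degree_add total_degree_single)

lemma vertex_splitting_keys: "vertex_splitting V d A \<Longrightarrow> a \<in> A \<Longrightarrow> keys a \<subseteq> V"
  by (induction arbitrary: a rule: vertex_splitting.induct) (auto simp: keys_add_nat, blast+)

lemma vertex_splitting_mono: "vertex_splitting V d A \<Longrightarrow> V \<subseteq> W \<Longrightarrow> vertex_splitting W d A"
proof (induction arbitrary: W rule: vertex_splitting.induct)
  case (split v V d A B)
  then have "v \<in> W" "V - {v} \<subseteq> W - {v}" by auto
  with split show ?case by (intro vertex_splitting.split)
qed (auto intro: vertex_splitting.intros)

lemma mon_single: "mon (single i 1) = var i"
  by (simp add: var_def)

lemma vertex_splitting_vertex_splittable:
  "vertex_splitting V d A \<Longrightarrow> vertex_splittable_in V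
      (monomial_ideal A :: ('n::finite, 'k::field) mpoly set)"
proof (induction rule: vertex_splitting.induct)
  case (empty V d)
  show ?case unfolding monomial_ideal_empty by (rule vertex_splittable_in.zero)
next
  case (singleton m V)
  then show ?case
    by (auto simp flip: ideal_gen_mon intro: vertex_splittable_in.principal)
next
  case (split v V d A B)
  let ?v = "single v 1 :: 'n \<Rightarrow>\<^sub>0 nat"
  let ?A = "(+) ?v ` A"
  have whole: "vertex_splitting V (Suc d) (?A \<union> B)"
    by (rule vertex_splitting.split) (use split in auto)
  have antichain: "antichain ?A" "antichain B" "antichain (?A \<union> B)"
    using vertex_splitting_degree[OF whole] by (auto intro!: antichain_same_degree[of _ "Suc d"])
  have var: "(*) (var v) ` monomial_ideal A = (monomial_ideal ?A :: ('n, 'k) mpoly set)"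
    by (simp add: monomial_ideal_translate flip: mon_single)
  have sub: "monomial_ideal ?A \<subseteq> (monomial_ideal (?A \<union> B) :: ('n, 'k) mpoly set)"
    "monomial_ideal B \<subseteq> (monomial_ideal (?A \<union> B) :: ('n, 'k) mpoly set)"
      by (auto intro: monomial_ideal_mono[THEN subsetD])
  show ?case
  proof (rule vertex_splittable_in.split[OF split(1) split(5) split(6)])
    show "monomial_ideal (?A \<union> B) = {var v * f + g |f g. f \<in> monomial_ideal A
        \<and> g \<in> (monomial_ideal B :: ('n, 'k) mpoly set)}"
    proof (intro equalityI subsetI)
      fix h :: "('n, 'k) mpoly" assume h: "h \<in> monomial_ideal (?A \<union> B)"
      let ?P = "\<lambda>m. \<exists>a\<in>?A. a \<preceq> m"
      have "restrict_keys ?P h \<in> (*) (var v) ` monomial_ideal A" unfolding var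
        by (rule monomial_ideal_union_split[OF h])
      then obtain f where "f \<in> monomial_ideal A" "restrict_keys ?P h = var v * f" by blast
      moreover have "restrict_keys (\<lambda>m. \<not> ?P m) h \<in> monomial_ideal B"
        by (rule monomial_ideal_union_split[OF h])
      moreover have "h = restrict_keys ?P h + restrict_keys (\<lambda>m. \<not> ?P m) h"
        by (rule restrict_keys_split[symmetric])
      ultimately show "h \<in> {var v * f + g |f g. f \<in> monomial_ideal A \<and> g \<in> monomial_ideal B}"
        by auto
    next
      fix h :: "('n, 'k) mpoly"
      assume "h \<in> {var v * f + g |f g. f \<in> monomial_ideal A \<and> g \<in> monomial_ideal B}"
      then obtain f g where "h = var v * f + g" "var v * f \<in> monomial_ideal ?A"
          "g \<in> monomial_ideal B"
        unfolding var[symmetric] by blast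
      then show "h \<in> monomial_ideal (?A \<union> B)" using sub by (auto intro: monomial_ideal_add)
    qed
    show "monomial_ideal B \<subseteq> (monomial_ideal A :: ('n, 'k) mpoly set)"
      unfolding monomial_ideal_subset_iff using split(4) by blast
    show "min_mon_gens (monomial_ideal (?A \<union> B)) =
        min_mon_gens ((*) (var v) ` monomial_ideal A) \<union> min_mon_gens
            (monomial_ideal B :: ('n, 'k) mpoly set)"
      unfolding var by (simp add: min_mon_gens_monomial_ideal antichain image_Un del: One_nat_def)
    have "v \<in> keys (?v + a)" for a by (simp add: keys_add_nat)
    moreover have "v \<notin> keys b" if "b \<in> B" for b using vertex_splitting_keys[OF split(3) that]
      by auto
    ultimately have "?A \<inter> B = {}" by auto
    then show "min_mon_gens ((*) (var v) ` monomial_ideal A)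
        \<inter> min_mon_gens (monomial_ideal B :: ('n, 'k) mpoly set) = {}"
      unfolding var by (simp add: min_mon_gens_monomial_ideal antichain image_Int[OF inj_mon,
          symmetric]
          del: One_nat_def)
  qed
qed

text \<open>The intersection of the two parts of a vertex splitting is \<open>x\<^sub>v I\<^sub>2\<close>, hence the
  Mayer-Vietoris sequence keeps the resolution linear.\<close>

lemma (in field_resolution) vertex_splitting_linear:
  "vertex_splitting V d A \<Longrightarrow> linear_tor d (monomial_ideal A)"
proof (induction rule: vertex_splitting.induct)
  case (empty V d)
  show ?case by (simp add: linear_tor_def tor_vanishes_zero)
next
  case (singleton m V)
  show ?case by (simp add: linear_tor_def tor_vanishes_principal)
next
  case (split v V d A B)
  let ?v = "single v 1 :: 'n \<Rightarrow>\<^sub>0 nat"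
  have "(\<exists>a\<in>A. ?v + a \<preceq> m) \<and> (\<exists>b\<in>B. b \<preceq> m) \<longleftrightarrow> (\<exists>b\<in>B. ?v + b \<preceq> m)" for m
  proof
    assume "(\<exists>a\<in>A. ?v + a \<preceq> m) \<and> (\<exists>b\<in>B. b \<preceq> m)"
    then obtain a b where a: "?v + a \<preceq> m" and b: "b \<in> B" "b \<preceq> m" by blast
    have v: "v \<notin> keys b" using vertex_splitting_keys[OF split(3) b(1)] by auto
    have "lookup (?v + b) i \<le> lookup m i" for i
    proof (cases "i = v")
      case True
      have "lookup (?v + a) v \<le> lookup m v" using a by (simp add: divides_def)
      then show ?thesis using v True by (simp add: lookup_add in_keys_iff)
    next
      case False
      then show ?thesis using b(2) by (simp add: lookup_add lookup_single divides_def)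
    qed
    then show "\<exists>b\<in>B. ?v + b \<preceq> m" using b(1) by (auto simp: divides_def)
  next
    assume "\<exists>b\<in>B. ?v + b \<preceq> m"
    then obtain b where b: "b \<in> B" "?v + b \<preceq> m" by blast
    then obtain a where a: "a \<in> A" "a \<preceq> b" using split(4) by blast
    have "?v + a \<preceq> m" using divides_trans[OF _ b(2), of "?v + a"] a(2) by simp
    moreover have "b \<preceq> m" using divides_trans[OF _ b(2), of b] by simp
    ultimately show "(\<exists>a\<in>A. ?v + a \<preceq> m) \<and> (\<exists>b\<in>B. b \<preceq> m)" using a(1) b(1) by blast
  qed
  then have Int: "monomial_ideal ((+) ?v ` A) \<inter> monomial_ideal B
      = (monomial_ideal ((+) ?v ` B) :: ('n, 'k) mpoly set)"
    by (simp add: monomial_ideal_def Int_def del: One_nat_def flip: ball_conj_distrib)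
  show ?case unfolding linear_tor_def
  proof (intro allI impI)
    fix i j assume j: "j \<noteq> int i + int (Suc d)"
    show "tor_vanishes (monomial_ideal ((+) ?v ` A \<union> B)) i j"
    proof (rule tor_vanishes_union[OF _ _ Int])
      show "tor_vanishes (monomial_ideal ((+) ?v ` A)) i j"
        using split(5) j by (intro tor_vanishes_translate)
            (simp add: linear_tor_def total_degree_single)
      show "tor_vanishes (monomial_ideal B) i j" using split(6) j by (simp add: linear_tor_def)
      fix q assume "i = Suc q"
      then show "tor_vanishes (monomial_ideal ((+) ?v ` B)) q j"
        using split(6) j by (intro tor_vanishes_translate)
            (simp add: linear_tor_def total_degree_single)
    qed
  qed
qed

subsection \<open>Ideals of complements\<close>

text \<open>
  Passing from \<open>V\<close> to \<open>V - {v}\<close> amounts to deleting the vertex \<open>v\<close> from \<open>H\<close>, because \<open>T\<close> then avoids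
  \<open>v\<close>; the contraction at \<open>v\<close> is \<open>(\<lambda>e. e - {v}) ` H\<close>.
\<close>

definition complement_gens :: "'n::finite set \<Rightarrow> 'n set set \<Rightarrow> nat \<Rightarrow> ('n \<Rightarrow>\<^sub>0 nat) set" where
  "complement_gens V H t = {chi (V - T) | T. T \<subseteq> V \<and> card T = t \<and> (\<exists>e\<in>H. e \<subseteq> T)}"

lemma complement_gensI:
  "T \<subseteq> V \<Longrightarrow> card T = t \<Longrightarrow> e \<in> H \<Longrightarrow> e \<subseteq> T \<Longrightarrow> chi (V - T) \<in> complement_gens V H t"
  by (auto simp: complement_gens_def)

lemma complement_gensE:
  assumes "m \<in> complement_gens V H t"
  obtains T e where "m = chi (V - T)" "T \<subseteq> V" "card T = t" "e \<in> H" "e \<subseteq> T"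
  using assms by (auto simp: complement_gens_def)

lemma chi_insert: "v \<notin> T \<Longrightarrow> chi (insert v T) = single v 1 + chi T"
  by (rule poly_mapping_eqI) (auto simp: lookup_chi lookup_add lookup_single when_def)

lemma keys_chi: "keys (chi T) = T"
  by (auto simp: in_keys_iff lookup_chi split: if_splits)

lemma chi_divides_chi: "S \<subseteq> T \<Longrightarrow> chi S \<preceq> chi T"
  by (auto simp: chi_divides_iff lookup_chi)

text \<open>The sets without \<open>v\<close> give the generators divisible by \<open>x\<^sub>v\<close>, the sets with \<open>v\<close> the other
  ones.\<close>

lemma complement_gens_split:
  assumes v: "v \<in> V"
  shows "complement_gens V H (Suc t) = (+) (single v 1) ` complement_gens (V - {v}) H (Suc t)
    \<union> complement_gens (V - {v}) ((\<lambda>e. e - {v}) ` H) t" (is "?L = ?R1 \<union> ?R2")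
proof (intro equalityI subsetI)
  fix m assume "m \<in> ?L"
  then obtain T e where T: "m = chi (V - T)" "T \<subseteq> V" "card T = Suc t" "e \<in> H" "e \<subseteq> T"
    by (auto simp: complement_gens_def)
  show "m \<in> ?R1 \<union> ?R2"
  proof (cases "v \<in> T")
    case True
    have "V - T = V - {v} - (T - {v})" "T - {v} \<subseteq> V - {v}" "card (T - {v}) = t" "e - {v} \<subseteq> T - {v}"
      using True T by auto
    then have "m \<in> ?R2" using T(1,4) complement_gensI[of "T - {v}" "V - {v}" t "e - {v}"] by simp
    then show ?thesis by blast
  next
    case False
    have "V - T = insert v (V - {v} - T)" using False v by auto
    then have "m = single v 1 + chi (V - {v} - T)" using T(1) by (simp add: chi_insert)
    moreover have "T \<subseteq> V - {v}" using False T(2) by auto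
    ultimately have "m \<in> ?R1" using T complement_gensI[of T "V - {v}" "Suc t" e H] by simp
    then show ?thesis by blast
  qed
next
  fix m assume "m \<in> ?R1 \<union> ?R2"
  then show "m \<in> ?L"
  proof
    assume "m \<in> ?R1"
    then obtain T e where T: "m = single v 1 + chi (V - {v} - T)" "T \<subseteq> V - {v}" "card T = Suc t"
      "e \<in> H" "e \<subseteq> T" by (auto simp: complement_gens_def)
    moreover have "V - T = insert v (V - {v} - T)" using v T(2) by auto
    ultimately have "m = chi (V - T)" by (simp add: chi_insert)
    moreover have "T \<subseteq> V" using T(2) by blast
    ultimately show ?thesis using complement_gensI[of T V "Suc t" e H] T by simp
  next
    assume "m \<in> ?R2"
    then obtain T e where T: "m = chi (V - {v} - T)" "T \<subseteq> V - {v}" "card T = t"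
      "e \<in> H" "e - {v} \<subseteq> T" by (auto simp: complement_gens_def)
    have "V - {v} - T = V - insert v T" by auto
    moreover have "card (insert v T) = Suc t" using T(2,3) by (subst card_insert_disjoint) auto
    moreover have "insert v T \<subseteq> V" "e \<subseteq> insert v T" using T v by auto
    ultimately show ?thesis using complement_gensI[of "insert v T" V "Suc t" e H] T(1,4) by simp
  qed
qed

text \<open>In the extreme cases there is only one set \<open>T\<close>, hence at most one generator.\<close>

lemma vertex_splitting_complement_gens_trivial:
  assumes "t = 0 \<or> t = card V"
  shows "vertex_splitting V (card V - t) (complement_gens V H t)"
proof -
  have ex: "\<exists>T. \<forall>m. m \<in> complement_gens V H t \<longrightarrow> m = chi (V - T) \<and> T \<subseteq> V \<and> card T = t"
  proof (cases "t = 0")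
    case True
    then show ?thesis by (intro exI[of _ "{}"]) (auto simp: complement_gens_def)
  next
    case False
    with assms have "t = card V" by simp
    then have "T = V" if "T \<subseteq> V" "card T = t" for T using that card_subset_eq[of V T] by simp
    then have "m = chi (V - V) \<and> V \<subseteq> V \<and> card V = t" if "m \<in> complement_gens V H t" for m
      using complement_gensE[OF that] \<open>t = card V\<close> by (metis order_refl)
    then show ?thesis by blast
  qed
  then obtain T where T: "\<And>m. m \<in> complement_gens V H t \<Longrightarrow> m = chi (V - T) \<and> T \<subseteq> V \<and> card T = t"
    by blast
  show ?thesis
  proof (cases "complement_gens V H t = {}")
    case True
    then show ?thesis by (simp add: vertex_splitting.empty)
  next
    case False
    then have "complement_gens V H t = {chi (V - T)}" "T \<subseteq> V" "card T = t" using T by auto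
    moreover from this(2,3) have "total_degree (chi (V - T)) = card V - t"
      by (simp add: total_degree_chi card_Diff_subset)
    ultimately show ?thesis
      using vertex_splitting.singleton[of "chi (V - T)" V] by (simp add: keys_chi)
  qed
qed

text \<open>
  The last hypothesis yields the inclusion \<open>I\<^sub>2 \<subseteq> I\<^sub>1\<close> that a vertex splitting requires. Complements
  reverse inclusions, so a generator of \<open>I\<^sub>2\<close> is divisible by one of \<open>I\<^sub>1\<close> as soon as its set \<open>T\<close> can be
  enlarged by one point to a set that contains a member of the deletion.
\<close>

lemma vertex_splitting_complement_gens_split:
  assumes v: "v \<in> V" "Suc t < card V"
    and del: "vertex_splitting (V - {v}) (card (V - {v}) - Suc t)
        (complement_gens (V - {v}) H (Suc t))"
    and con: "vertex_splitting (V - {v}) (card (V - {v}) - t)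
      (complement_gens (V - {v}) ((\<lambda>e. e - {v}) ` H) t)"
    and shed: "\<And>T e. T \<subseteq> V - {v} \<Longrightarrow> card T = t \<Longrightarrow> e \<in> H \<Longrightarrow> e - {v} \<subseteq> T \<Longrightarrow>
      \<exists>e'\<in>H. e' \<subseteq> V - {v} \<and> card (T \<union> e') \<le> Suc t"
  shows "vertex_splitting V (card V - Suc t) (complement_gens V H (Suc t))"
proof -
  have card: "card (V - {v}) = card V - 1" using v by simp
  have "vertex_splitting V (Suc (card (V - {v}) - Suc t)) (complement_gens V H (Suc t))"
    unfolding complement_gens_split[OF v(1)]
  proof (rule vertex_splitting.split[OF v(1)])
    show "vertex_splitting V (card (V - {v}) - Suc t) (complement_gens (V - {v}) H (Suc t))"
      by (rule vertex_splitting_mono[OF del]) auto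
    have "Suc (card (V - {v}) - Suc t) = card (V - {v}) - t" using v(2) card by simp
    then show "vertex_splitting (V - {v}) (Suc (card (V - {v}) - Suc t))
        (complement_gens (V - {v}) ((\<lambda>e. e - {v}) ` H) t)" using con by simp
  next
    fix b assume "b \<in> complement_gens (V - {v}) ((\<lambda>e. e - {v}) ` H) t"
    then obtain T e where T: "b = chi (V - {v} - T)" "T \<subseteq> V - {v}" "card T = t" "e \<in> H"
        "e - {v} \<subseteq> T"
      by (auto simp: complement_gens_def)
    then obtain e' where e': "e' \<in> H" "e' \<subseteq> V - {v}" "card (T \<union> e') \<le> Suc t"
      using shed[OF T(2-5)] by blast
    have "Suc t \<le> card (V - {v})" "T \<union> e' \<subseteq> V - {v}" using card v(2) T(2) e'(2) by auto
    from exists_subset_between[OF e'(3) this finite]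
    obtain T' where T': "T \<union> e' \<subseteq> T'" "T' \<subseteq> V - {v}" "card T' = Suc t" by blast
    then have "chi (V - {v} - T') \<in> complement_gens (V - {v}) H (Suc t)"
      by (intro complement_gensI[OF _ _ e'(1)]) auto
    moreover have "chi (V - {v} - T') \<preceq> b" unfolding T(1) by (rule chi_divides_chi) (use T' in auto)
    ultimately show "\<exists>a\<in>complement_gens (V - {v}) H (Suc t). a \<preceq> b" by blast
  qed
  moreover have "Suc (card (V - {v}) - Suc t) = card V - Suc t" using v(2) card by simp
  ultimately show ?thesis by simp
qed

text \<open>Every set can be enlarged to one that contains the point \<open>u\<close>, hence all other points may be
  split off, in any order.\<close>

lemma vertex_splitting_complement_gens_point:
  "u \<in> V \<Longrightarrow> {u} \<in> H \<Longrightarrow> t \<le> card V \<Longrightarrow> vertex_splitting V (card V - t) (complement_gens V H t)"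
proof (induction "card V" arbitrary: V H t rule: less_induct)
  case less
  show ?case
  proof (cases "t = 0 \<or> t = card V")
    case True
    then show ?thesis by (rule vertex_splitting_complement_gens_trivial)
  next
    case False
    then obtain s where t: "t = Suc s" "Suc s < card V" using less.prems by (cases t) auto
    have "\<not> V \<subseteq> {u}"
    proof
      assume "V \<subseteq> {u}"
      then have "card V \<le> 1" using card_mono[of "{u}" V] by simp
      with t show False by simp
    qed
    then obtain v where v: "v \<in> V" "v \<noteq> u" by blast
    have smaller: "card (V - {v}) < card V" by (rule card_Diff1_less[OF finite v(1)])
    have u: "u \<in> V - {v}" using v less.prems by blast
    have le: "Suc s \<le> card (V - {v})" using t(2) v(1) by simp
    show ?thesis unfolding t(1)
    proof (rule vertex_splitting_complement_gens_split[OF v(1) t(2)])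
      show "vertex_splitting (V - {v}) (card (V - {v}) - Suc s)
          (complement_gens (V - {v}) H (Suc s))"
        by (rule less.hyps[OF smaller u less.prems(2) le])
      have "{u} \<in> (\<lambda>e. e - {v}) ` H" using less.prems(2) v(2)
        by (intro image_eqI[of _ _ "{u}"]) auto
      then show "vertex_splitting (V - {v}) (card (V - {v}) - s)
          (complement_gens (V - {v}) ((\<lambda>e. e - {v}) ` H) s)"
        by (rule less.hyps[OF smaller u]) (use le in simp)
      fix T assume "T \<subseteq> V - {v}" "card T = s"
      moreover from this have "card (T \<union> {u}) \<le> Suc s" by (simp add: card_insert_if)
      ultimately show "\<exists>e'\<in>H. e' \<subseteq> V - {v} \<and> card (T \<union> e') \<le> Suc s"
        using less.prems(2) u by (intro bexI[of _ "{u}"]) auto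
    qed
  qed
qed

subsection \<open>Connected graphs\<close>

text \<open>
  This expresses connectedness up to isolated vertices in a form that provides the order in which
  the vertices are split off.
\<close>

inductive grown :: "'n set set \<Rightarrow> 'n set \<Rightarrow> bool" for E where
  edge: "{a, b} \<in> E \<Longrightarrow> a \<noteq> b \<Longrightarrow> grown E {a, b}"
| isolated: "grown E W \<Longrightarrow> v \<notin> W \<Longrightarrow> v \<notin> \<Union>E \<Longrightarrow> grown E (insert v W)"
| adjacent: "grown E W \<Longrightarrow> v \<notin> W \<Longrightarrow> w \<in> W \<Longrightarrow> {v, w} \<in> E \<Longrightarrow> grown E (insert v W)"

lemma grown_incident:
  "grown E W \<Longrightarrow> w \<in> W \<Longrightarrow> w \<in> \<Union>E \<Longrightarrow> \<exists>e\<in>E. w \<in> e \<and> e \<subseteq> W"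
proof (induction rule: grown.induct)
  case (edge a b)
  then show ?case by (intro bexI[of _ "{a, b}"]) auto
next
  case (isolated W v)
  then have "w \<in> W" by auto
  with isolated.IH isolated.prems show ?case by blast
next
  case (adjacent W v w')
  show ?case
  proof (cases "w = v")
    case True
    then show ?thesis using adjacent.hyps by (intro bexI[of _ "{v, w'}"]) auto
  next
    case False
    with adjacent.prems have "w \<in> W" by simp
    with adjacent.IH adjacent.prems show ?thesis by blast
  qed
qed

text \<open>
  The vertex that was added last is split off. Its contraction contains a point if the vertex has a
  neighbour, and is the old graph if it is isolated. The neighbours of the vertex are incident with
  old edges, which gives the required inclusion.
\<close>

lemma vertex_splitting_grown:
  assumes "grown E V" "\<And>e. e \<in> E \<Longrightarrow> card e = 2" "t \<le> card V"
  shows "vertex_splitting V (card V - t) (complement_gens V E t)"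
  using assms(1,3)
proof (induction arbitrary: t rule: grown.induct)
  case (edge a b)
  show ?case
  proof (cases "t = 1")
    case True
    have "\<not> e \<subseteq> T" if "e \<in> E" "card T = 1" for e T
      using assms(2)[OF that(1)] that(2) card_mono[of T e] by auto
    then have "complement_gens {a, b} E t = {}" using True by (auto simp: complement_gens_def)
    then show ?thesis by (simp add: vertex_splitting.empty)
  next
    case False
    then have "t = 0 \<or> t = card {a, b}" using edge by auto
    then show ?thesis by (rule vertex_splitting_complement_gens_trivial)
  qed
next
  case (isolated W v)
  have W: "insert v W - {v} = W" "card (insert v W) = Suc (card W)" using isolated(2) by auto
  show ?case
  proof (cases "t = 0 \<or> t = card (insert v W)")
    case True
    then show ?thesis by (rule vertex_splitting_complement_gens_trivial)
  next
    case False
    then obtain s where t: "t = Suc s" "Suc s < card (insert v W)" using isolated.prems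
      by (cases t) auto
    have E: "(\<lambda>e. e - {v}) ` E = E" using isolated(3) by (force simp: image_iff)
    show ?thesis unfolding t(1)
    proof (rule vertex_splitting_complement_gens_split[OF insertI1 t(2)]; (unfold W E)?)
      fix T e assume T: "T \<subseteq> W" "card T = s" "e \<in> E" "e - {v} \<subseteq> T"
      then have "e \<subseteq> T" using isolated(3) by auto
      moreover from this have "T \<union> e = T" by blast
      ultimately show "\<exists>e'\<in>E. e' \<subseteq> W \<and> card (T \<union> e') \<le> Suc s"
        using T by (intro bexI[of _ e]) auto
    qed (use t W isolated.IH in auto)
  qed
next
  case (adjacent W v w)
  have W: "insert v W - {v} = W" "card (insert v W) = Suc (card W)" using adjacent(2) by auto
  show ?case
  proof (cases "t = 0 \<or> t = card (insert v W)")
    case True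
    then show ?thesis by (rule vertex_splitting_complement_gens_trivial)
  next
    case False
    then obtain s where t: "t = Suc s" "Suc s < card (insert v W)" using adjacent.prems
      by (cases t) auto
    have "{w} \<in> (\<lambda>e. e - {v}) ` E" using adjacent by (intro image_eqI[of _ _ "{v, w}"]) auto
    then have con: "vertex_splitting W (card W - s) (complement_gens W ((\<lambda>e. e - {v}) ` E) s)"
      using t W adjacent(3) by (intro vertex_splitting_complement_gens_point[of w]) auto
    show ?thesis unfolding t(1)
    proof (rule vertex_splitting_complement_gens_split[OF insertI1 t(2)]; (unfold W)?)
      fix T e assume T: "T \<subseteq> W" "card T = s" "e \<in> E" "e - {v} \<subseteq> T"
      show "\<exists>e'\<in>E. e' \<subseteq> W \<and> card (T \<union> e') \<le> Suc s"
      proof (cases "v \<in> e")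
        case False
        then have "T \<union> e = T" "e \<subseteq> W" using T by auto
        then show ?thesis using T by (intro bexI[of _ e]) auto
      next
        case True
        \<comment> \<open>The other end of the edge \<open>e\<close> already has a neighbour among the old vertices.\<close>
        then obtain x where x: "x \<in> e" "x \<noteq> v"
          using assms(2)[OF T(3)] by (metis card_2_iff insertI1 insertI2 singletonD insertE)
        then have "x \<in> T" "x \<in> W" using T by auto
        then obtain e' where e': "e' \<in> E" "x \<in> e'" "e' \<subseteq> W"
          using grown_incident[OF adjacent(1), of x] T(3) x(1) by blast
        obtain y where "e' = {x, y}" using assms(2)[OF e'(1)] e'(2) by (auto simp: card_2_iff)
        then have "T \<union> e' = insert y T" using \<open>x \<in> T\<close> by auto
        then show ?thesis using e' T(2) by (intro bexI[of _ e']) (auto simp: card_insert_if)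
      qed
    qed (use t W adjacent.IH con in auto)
  qed
qed

text \<open>A maximal set that can be grown either is everything or cannot be left along an edge.\<close>

lemma grown_or_disconnected:
  fixes E :: "'n::finite set set"
  assumes "E \<noteq> {}" "\<And>e. e \<in> E \<Longrightarrow> card e = 2"
  obtains "grown E UNIV"
    | W e f where "\<And>e. e \<in> E \<Longrightarrow> e \<subseteq> W \<or> e \<subseteq> - W" "e \<in> E" "e \<subseteq> W" "f \<in> E" "f \<subseteq> - W"
proof -
  obtain a b where ab: "{a, b} \<in> E" "a \<noteq> b" using assms by (metis all_not_in_conv card_2_iff)
  have "finite {W. grown E W}" "{W. grown E W} \<noteq> {}" using grown.edge[OF ab] by auto
  then obtain W where W: "grown E W" and max: "\<And>W'. grown E W' \<Longrightarrow> W \<subseteq> W' \<Longrightarrow> W' = W"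
    using finite_has_maximal[of "{W. grown E W}"] by auto
  show thesis
  proof (cases "W = UNIV")
    case True
    then show ?thesis using W that(1) by simp
  next
    case False
    then obtain v where v: "v \<notin> W" by blast
    have no_growth: "\<not> grown E (insert x W)" if "x \<notin> W" for x
      using max[of "insert x W"] that by blast
    obtain f where f: "f \<in> E" "v \<in> f" using grown.isolated[OF W v] no_growth[OF v] by blast
    have sep: "e \<subseteq> W \<or> e \<subseteq> - W" if e: "e \<in> E" for e
    proof (rule ccontr)
      assume "\<not> ?thesis"
      then obtain x y where "x \<in> e" "x \<notin> W" "y \<in> e" "y \<in> W" by blast
      moreover from this have "e = {x, y}" using assms(2)[OF e] by (auto simp: card_2_iff)
      ultimately show False using grown.adjacent[OF W, of x y] no_growth e by blast
    qed
    moreover have "\<exists>e\<in>E. e \<subseteq> W" using W by (induction rule: grown.induct) auto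
    moreover have "f \<subseteq> - W" using sep[OF f(1)] f(2) v by blast
    ultimately show ?thesis using that(2) f(1) by blast
  qed
qed

section \<open>Connectedness and the iterated gradient ideals\<close>

lemma tor_dim_resolution:
  obtains F :: "('n::finite, 'k::field) free_complex" where "field_resolution F"
    "\<And>A i j. tor_dim (monomial_ideal A :: ('n, 'k) mpoly set) i j \<noteq> 0 \<longleftrightarrow>
      \<not> field_resolution.tor_vanishes F (monomial_ideal A) i j"
proof -
  define F :: "('n, 'k) free_complex" where "F = (SOME F. graded_free_resolution_of_field F)"
  have F: "field_resolution F"
    unfolding field_resolution_def F_def by (rule someI, rule word_complex_resolution)
  show thesis
    by (rule that[OF F])
      (use field_resolution.homology_dim_iff[OF F] in \<open>simp add: tor_dim_def F_def[symmetric]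
          Let_def\<close>)
qed

lemma finite_regularity_set:
  assumes "finite A"
  shows "finite {j - int i | i j. tor_dim (monomial_ideal A :: ('n::finite, 'k::field) mpoly set)
      i j \<noteq> 0}"
proof -
  obtain F :: "('n, 'k) free_complex" where F: "field_resolution F"
    "\<And>A i j. tor_dim (monomial_ideal A :: ('n, 'k) mpoly set) i j \<noteq> 0 \<longleftrightarrow>
      \<not> field_resolution.tor_vanishes F (monomial_ideal A) i j"
    using tor_dim_resolution by blast
  obtain R where R: "finite R"
    "\<And>i j. j - int i \<notin> R \<Longrightarrow> field_resolution.tor_vanishes F (monomial_ideal A) i j"
    using field_resolution.tor_bounded[OF F(1) assms] by blast
  have "{j - int i | i j. tor_dim (monomial_ideal A :: ('n, 'k) mpoly set) i j \<noteq> 0} \<subseteq> R"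
    using R(2) F(2) by blast
  then show ?thesis using R(1) finite_subset by blast
qed

lemma regularity_vertex_splitting:
  assumes A: "vertex_splitting V d A" "A \<noteq> {}"
  shows "regularity (monomial_ideal A :: ('n::finite, 'k::field) mpoly set) = int d"
proof -
  obtain F :: "('n, 'k) free_complex" where F: "field_resolution F"
    "\<And>A i j. tor_dim (monomial_ideal A :: ('n, 'k) mpoly set) i j \<noteq> 0 \<longleftrightarrow>
      \<not> field_resolution.tor_vanishes F (monomial_ideal A) i j"
    using tor_dim_resolution by blast
  interpret field_resolution F by (rule F(1))
  let ?R = "{j - int i | i j. tor_dim (monomial_ideal A :: ('n, 'k) mpoly set) i j \<noteq> 0}"
  have "?R \<subseteq> {int d}"
    using vertex_splitting_linear[OF A(1)] F(2)[of A] by (force simp: linear_tor_def)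
  moreover have "tor_dim (monomial_ideal A :: ('n, 'k) mpoly set) 0 (int d) \<noteq> 0"
    using not_tor_vanishes_zero[OF vertex_splitting_degree[OF A(1)]] A(2) F(2)[of A] by blast
  then have "int d \<in> ?R" by force
  ultimately have "?R = {int d}" by blast
  then show ?thesis by (simp add: regularity_def)
qed

lemma complement_gens_edges:
  assumes "\<And>e. e \<in> E \<Longrightarrow> card e = t"
  shows "complement_gens UNIV E t = (\<lambda>e. chi (- e)) ` E"
proof (intro equalityI subsetI)
  fix m assume "m \<in> complement_gens UNIV E t"
  then obtain T e where T: "m = chi (UNIV - T)" "card T = t" "e \<in> E" "e \<subseteq> T"
    by (rule complement_gensE)
  then have "e = T" using assms[OF T(3)] by (intro card_subset_eq) auto
  then show "m \<in> (\<lambda>e. chi (- e)) ` E" using T by (auto simp: Compl_eq_Diff_UNIV)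
next
  fix m assume "m \<in> (\<lambda>e. chi (- e)) ` E"
  then obtain e where "e \<in> E" "m = chi (UNIV - e)" by (auto simp: Compl_eq_Diff_UNIV)
  then show "m \<in> complement_gens UNIV E t" using complement_gensI[of e UNIV t e E] assms by simp
qed

lemma complement_gens_total_degree: "m \<in> complement_gens V H t \<Longrightarrow> total_degree m = card V - t"
  by (erule complement_gensE) (simp add: total_degree_chi card_Diff_subset)

text \<open>
  A separation of the edges would split the ideal into two parts that meet in the principal ideal
  of the product of all variables, which produces a first syzygy that is not linear.
\<close>

lemma linear_imp_grown:
  fixes E :: "'n::finite set set"
  assumes E: "E \<noteq> {}" "\<And>e. e \<in> E \<Longrightarrow> card e = 2"
    and reg: "regularity (monomial_ideal (complement_gens UNIV E 2) :: ('n, 'k::field) mpoly set)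
      = int CARD('n) - 2"
  shows "grown E UNIV"
proof (rule grown_or_disconnected[OF E])
  fix W e f assume sep: "\<And>e. e \<in> E \<Longrightarrow> e \<subseteq> W \<or> e \<subseteq> - W" and e: "e \<in> E" "e \<subseteq> W" and f: "f \<in> E"
      "f \<subseteq> - W"
  obtain F :: "('n, 'k) free_complex" where F: "field_resolution F"
    "\<And>A i j. tor_dim (monomial_ideal A :: ('n, 'k) mpoly set) i j \<noteq> 0 \<longleftrightarrow>
      \<not> field_resolution.tor_vanishes F (monomial_ideal A) i j"
    using tor_dim_resolution by blast
  interpret field_resolution F by (rule F(1))
  let ?c = "\<lambda>e :: 'n set. chi (- e)"
  let ?A = "?c ` {e \<in> E. e \<subseteq> W}" and ?B = "?c ` {e \<in> E. e \<subseteq> - W}"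
  have union: "complement_gens UNIV E 2 = ?A \<union> ?B"
  proof -
    have "E = {e \<in> E. e \<subseteq> W} \<union> {e \<in> E. e \<subseteq> - W}" using sep by blast
    moreover have "complement_gens UNIV E 2 = ?c ` E" by (rule complement_gens_edges) (rule E(2))
    ultimately show ?thesis by (simp flip: image_Un)
  qed
  have "(\<exists>a\<in>?A. a \<preceq> m) \<and> (\<exists>b\<in>?B. b \<preceq> m) \<longleftrightarrow> chi UNIV \<preceq> m" for m
    unfolding chi_divides_iff using e f by (auto simp: chi_divides_iff) blast
  then have Int: "monomial_ideal ?A \<inter> monomial_ideal ?B
      = (monomial_ideal {chi UNIV} :: ('n, 'k) mpoly set)"
    unfolding monomial_ideal_def Int_def by (simp flip: ball_conj_distrib)
  have proper: "?c e \<preceq> chi UNIV \<and> ?c e \<noteq> chi UNIV" if "e \<in> E" for e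
  proof -
    have "e \<noteq> {}" using E(2)[OF that] by auto
    then have "- e \<noteq> UNIV" by auto
    then show ?thesis using keys_chi chi_divides_chi[of "- e" UNIV] by (metis subset_UNIV)
  qed
  have "\<not> tor_vanishes (monomial_ideal (?A \<union> ?B)) 1 (int (total_degree (chi UNIV :: 'n \<Rightarrow>\<^sub>0 nat)))"
    by (rule not_tor_vanishes_union[OF Int, of "?c e" "?c f"]) (use proper e f in auto)
  then have "tor_dim (monomial_ideal (?A \<union> ?B) :: ('n, 'k) mpoly set) 1 (int CARD('n)) \<noteq> 0"
    unfolding F(2) by (simp add: total_degree_chi)
  then have "int CARD('n) - int 1
      \<in> {j - int i | i j. tor_dim (monomial_ideal (?A \<union> ?B) :: ('n, 'k) mpoly set) i j \<noteq> 0}"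
        by blast
  then have "int CARD('n) - int 1 \<le> regularity (monomial_ideal (?A \<union> ?B) :: ('n, 'k) mpoly set)"
    unfolding regularity_def by (intro Max_ge finite_regularity_set) auto
  then show ?thesis using reg unfolding union by simp
qed

text \<open>Dividing \<open>x\<^bsub>[n] - T\<^esub>\<close> by \<open>x\<^sub>i\<close> adds \<open>i\<close> to \<open>T\<close>. Conversely, a set that is larger than a member
  \<open>e\<close> of \<open>E\<close> contained in it has a point outside of \<open>e\<close>, which can be removed.\<close>

lemma quotient_exponents_complement_gens:
  fixes E :: "'n::finite set set"
  assumes "\<And>e. e \<in> E \<Longrightarrow> card e \<le> t"
  shows "quotient_exponents (complement_gens UNIV E t) = complement_gens UNIV E (Suc t)"
proof (intro equalityI subsetI)
  fix b assume "b \<in> quotient_exponents (complement_gens UNIV E t)"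
  then obtain i where "single i 1 + b \<in> complement_gens UNIV E t"
    by (auto simp: quotient_exponents_def)
  then obtain T e where T: "single i 1 + b = chi (UNIV - T)" "card T = t" "e \<in> E" "e \<subseteq> T"
    by (rule complement_gensE)
  have "i \<in> keys (single i 1 + b)" by (simp add: keys_add_nat)
  then have i: "i \<notin> T" unfolding T(1) keys_chi by simp
  then have "UNIV - T = insert i (UNIV - insert i T)" by auto
  then have "chi (UNIV - T) = single i 1 + chi (UNIV - insert i T)"
    using chi_insert[of i "UNIV - insert i T"] by simp
  then have "b = chi (UNIV - insert i T)" using T(1) by simp
  moreover have "card (insert i T) = Suc t" using i T(2) by simp
  moreover have "e \<subseteq> insert i T" using T(4) by blast
  ultimately show "b \<in> complement_gens UNIV E (Suc t)"
    using complement_gensI[OF subset_UNIV _ T(3), of "insert i T" "Suc t"] by simp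
next
  fix b assume "b \<in> complement_gens UNIV E (Suc t)"
  then obtain T e where T: "b = chi (UNIV - T)" "card T = Suc t" "e \<in> E" "e \<subseteq> T"
    by (rule complement_gensE)
  have "e \<noteq> T" using assms[OF T(3)] T(2) by auto
  then obtain i where i: "i \<in> T" "i \<notin> e" using T(4) by blast
  have "insert i (UNIV - T) = UNIV - (T - {i})" using i by auto
  then have "single i 1 + b = chi (UNIV - (T - {i}))"
    using chi_insert[of i "UNIV - T"] T(1) i by simp
  moreover have "chi (UNIV - (T - {i})) \<in> complement_gens UNIV E t"
    by (rule complement_gensI[OF _ _ T(3)]) (use T i in auto)
  ultimately show "b \<in> quotient_exponents (complement_gens UNIV E t)"
    unfolding quotient_exponents_def by (intro CollectI exI[of _ i]) simp
qed

text \<open>A minimal generator has degree \<open>n - 2\<close> and is squarefree, so its support is the complement of a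
  two-element set. The complements of the supports are the edges.\<close>

lemma squarefree_linear_edges:
  fixes I :: "('n::finite, 'k::field) mpoly set"
  assumes squarefree: "squarefree_monomial_ideal I"
    and linear: "has_linear_resolution (int CARD('n) - 2) I"
  obtains E where "E \<noteq> {}" "\<And>e. e \<in> E \<Longrightarrow> card e = 2" "I = monomial_ideal (complement_gens UNIV E 2)"
proof -
  obtain G where G: "G \<subseteq> mon ` {m. \<forall>i. lookup m i \<le> 1}" "I = ideal_gen G"
    using squarefree by (auto simp: squarefree_monomial_ideal_def)
  then obtain B where B: "B \<subseteq> {m. \<forall>i. lookup m i \<le> 1}" "G = mon ` B" by (meson subset_imageE)
  have chi: "m = chi (keys m)" if "m \<in> B" for m
  proof (rule poly_mapping_eqI)
    fix i
    have "lookup m i \<le> 1" using B that by blast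
    then show "lookup m i = lookup (chi (keys m)) i" by (auto simp: lookup_chi in_keys_iff)
  qed
  then have "B \<subseteq> range chi" by blast
  then have "finite B" by (rule finite_subset) simp
  then obtain A where A: "A \<subseteq> B" "antichain A"
      "monomial_ideal A = (monomial_ideal B :: ('n, 'k) mpoly set)"
    using exists_antichain by blast
  have I: "I = monomial_ideal A" using G(2) B(2) A(3) by (simp add: ideal_gen_mon)
  have "minimal_homogeneous_generating_set (mon ` A) I"
    using A(2) by (auto simp: I minimal_homogeneous_generating_set_def
        minimal_generating_set_mon_iff homogeneous_mon)
  then have "homogeneous (int CARD('n) - 2) (mon a :: ('n, 'k) mpoly)" if "a \<in> A" for a
    using linear that by (auto simp: has_linear_resolution_def)
  then have deg: "int (total_degree a) = int CARD('n) - 2" if "a \<in> A" for a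
    using that by (simp add: homogeneous_mon)
  let ?E = "(\<lambda>a. - keys a) ` A"
  have card: "card e = 2" if e: "e \<in> ?E" for e
  proof -
    obtain a where a: "a \<in> A" "e = - keys a" using e by blast
    have "card (keys a) = total_degree a" using chi[of a] a(1) A(1) total_degree_chi[of "keys a"]
      by auto
    then show ?thesis
      using deg[OF a(1)] by (simp add: a(2) Compl_eq_Diff_UNIV card_Diff_subset)
  qed
  have "(\<lambda>e. chi (- e)) ` ?E = (\<lambda>a. chi (keys a)) ` A" by (simp add: image_image)
  also have "\<dots> = A" using chi A(1) by (force simp: image_iff)
  finally have "complement_gens UNIV ?E 2 = A" by (simp add: complement_gens_edges[OF card])
  moreover have "A \<noteq> {}" using linear I
    by (auto simp: has_linear_resolution_def monomial_ideal_empty)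
  ultimately show thesis using that[of ?E] card I by simp
qed

theorem theorem4p3:
  fixes I :: "('n::finite, 'k::field) mpoly set"
  assumes char: "CHAR('k) = 0 \<or>
      (\<forall>l. int l < int CARD('n) - 2 \<longrightarrow>
        gradient_ideal ((gradient_ideal ^^ l) I) = monomial_gradient ((gradient_ideal ^^ l) I))"
    and squarefree: "squarefree_monomial_ideal I"
    and linear: "has_linear_resolution (int CARD('n) - 2) I"
  shows "\<forall>l. int l \<le> int CARD('n) - 2 \<longrightarrow>
      vertex_splittable ((gradient_ideal ^^ l) I) \<and>
      regularity ((gradient_ideal ^^ l) I) = int CARD('n) - 2 - int l"
proof -
  obtain E where E: "E \<noteq> {}" "\<And>e. e \<in> E \<Longrightarrow> card e = 2"
    and I: "I = monomial_ideal (complement_gens UNIV E 2)"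
    using squarefree_linear_edges[OF squarefree linear] by blast
  have grown: "grown E UNIV"
    using linear E I linear_imp_grown[of E] by (auto simp: has_linear_resolution_def)
  have iterate: "(gradient_ideal ^^ l) I = monomial_ideal (complement_gens UNIV E (l + 2))"
    if "int l \<le> int CARD('n) - 2" for l
    using that
  proof (induction l)
    case 0
    then show ?case by (simp add: I numeral_2_eq_2)
  next
    case (Suc l)
    let ?A = "complement_gens UNIV E (l + 2)"
    have l: "int l < int CARD('n) - 2" using Suc.prems by simp
    have antichain: "antichain ?A" by (rule antichain_same_degree)
        (rule complement_gens_total_degree)
    have "0 \<notin> ?A" using complement_gens_total_degree[of 0 UNIV E "l + 2"] l by auto
    have "(gradient_ideal ^^ Suc l) I = gradient_ideal (monomial_ideal ?A)" using Suc l by simp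
    also have "\<dots> = monomial_ideal (quotient_exponents ?A)"
      using char
    proof
      assume "CHAR('k) = 0"
      then show ?thesis by (rule gradient_ideal_eq[OF _ antichain \<open>0 \<notin> ?A\<close>])
    next
      assume "\<forall>l. int l < int CARD('n) - 2 \<longrightarrow>
        gradient_ideal ((gradient_ideal ^^ l) I) = monomial_gradient ((gradient_ideal ^^ l) I)"
      then have "gradient_ideal (monomial_ideal ?A :: ('n, 'k) mpoly set)
          = monomial_gradient (monomial_ideal ?A)"
        using l unfolding Suc.IH[OF less_imp_le[OF l], symmetric] by blast
      then show ?thesis by (simp only: monomial_gradient_eq[OF antichain])
    qed
    also have "quotient_exponents ?A = complement_gens UNIV E (Suc l + 2)"
      using E(2) by (subst quotient_exponents_complement_gens) auto
    finally show ?case .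
  qed
  show ?thesis
  proof (intro allI impI)
    fix l assume l: "int l \<le> int CARD('n) - 2"
    let ?A = "complement_gens UNIV E (l + 2)"
    have le: "l + 2 \<le> CARD('n)" using l by linarith
    have split: "vertex_splitting UNIV (CARD('n) - (l + 2)) ?A"
      by (rule vertex_splitting_grown[OF grown E(2) le])
    obtain e where e: "e \<in> E" using E(1) by blast
    have "card e \<le> l + 2" using E(2)[OF e] by simp
    from exists_subset_between[OF this le subset_UNIV finite]
    obtain T where "e \<subseteq> T" "card T = l + 2" by blast
    then have "?A \<noteq> {}" using complement_gensI[OF subset_UNIV _ e] by blast
    then have "regularity (monomial_ideal ?A :: ('n, 'k) mpoly set) = int (CARD('n) - (l + 2))"
      by (rule regularity_vertex_splitting[OF split])
    then show "vertex_splittable ((gradient_ideal ^^ l) I) \<and>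
        regularity ((gradient_ideal ^^ l) I) = int CARD('n) - 2 - int l"
      using vertex_splitting_vertex_splittable[OF split] le
      by (simp add: iterate[OF l] vertex_splittable_def)
  qed
qed

end
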